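(* (i) For each $a>0$, $$ 1-G(a+it)=\int_0^\infty e^{-its}e^{-as}\varphi(s)\,ds,\quad t\in\mathbb R, $$ is an analytic positive definite function of $t$, and it is the Fourier transform of $s\mapsto e^{-as}\varphi(s)1_{[0,\infty)}(s)$. (ii) For each $a>0$, $G(a+it)-G(a)$ is a continuous negative definite function of $t\in\mathbb R$. In particular, $$ \operatorname{Re} G(a+it)\ge G(a),\quad a>0,\ t\in\mathbb R. $$ (iii) For each $a\ge 1$, $G(a+it)$ is a continuous negative definite function of $t\in\mathbb R$.
   Context: Let $\mathcal A=\mathbb C\setminus(-\infty,0]$ and let $\operatorname{Log} z=\ln|z|+i\operatorname{Arg} z$ be the principal logarithm on $\mathcal A$, with $-\pi<\operatorname{Arg} z<\pi$. The function $G$ is defined by $$ G(z)=\left(1-\frac{\operatorname{Log} z}{\operatorname{Log}(1+z)}\right)z\operatorname{Log} z,\quad z\in\mathcal A. $$ The function $\rho$ on $(0,\infty)$ is defined by $$ \rho(t)=\begin{cases} -\dfrac{t\ln\left((1-t)/t^2\right)}{\ln(1-t)}, & 0<t<1,\\[2ex] -\dfrac{t\left(\ln\left((t-1)/t\right)\right)^2}{(\ln(t-1))^2+\pi^2}, & 1<t<\infty, \end{cases} $$ extended continuously by $\rho(1)=-1$; it is integrable over $(0,\infty)$. Put $\varphi(s)=\int_0^\infty e^{-st}\rho(t)\,dt$ for $s\ge 0$. The Fourier transform of $f\in L^1(\mathbb R)$ is $t\mapsto\int_{-\infty}^\infty e^{-its}f(s)\,ds$. A function $F:\mathbb R\to\mathbb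 C$ is positive definite if for all $n\ge 1$ and $t_1,\ldots,t_n\in\mathbb R$ the matrix $(F(t_j-t_k))_{j,k}$ is Hermitian positive semidefinite. A function $H:\mathbb R\to\mathbb C$ is negative definite if for all $n\ge 1$ and $t_1,\ldots,t_n\in\mathbb R$ the matrix $\left(H(t_j)+\overline{H(t_k)}-H(t_j-t_k)\right)_{j,k}$ is Hermitian positive semidefinite. "Analytic" means real-analytic on $\mathbb R$. *)

theory Defs
  imports "HOL-Analysis.Analysis"
begin

text \<open>
  On the cut plane, the library's \<^const>\<open>Ln\<close> is the principal logarithm.  Values of
  \<open>G\<close> on the cut carry no meaning.
\<close>

definition G :: "complex \<Rightarrow> complex" where
  "G z = (1 - Ln z / Ln (1 + z)) * z * Ln z"

text \<open>Only the values on \<open>(0,\<infinity>)\<close> matter; the value at \<open>1\<close> is the limit from both sides.\<close>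

definition rho :: "real \<Rightarrow> real" where
  "rho t =
     (if t \<le> 0 then 0
      else if t < 1 then - (t * ln ((1 - t) / t\<^sup>2)) / ln (1 - t)
      else if t = 1 then - 1
      else - (t * (ln ((t - 1) / t))\<^sup>2) / ((ln (t - 1))\<^sup>2 + pi\<^sup>2))"

definition phi :: "real \<Rightarrow> real" where
  "phi s = (LINT t:{0<..}|lborel. exp (- (s * t)) * rho t)"

text \<open>The Bochner integral is \<open>0\<close> for \<open>f\<close> not integrable, so \<open>f \<in> L\<^sup>1\<close> has to be stated separately.\<close>

definition fourier_transform :: "(real \<Rightarrow> complex) \<Rightarrow> real \<Rightarrow> complex" where
  "fourier_transform f t =
     (LINT s|lborel. exp (- (\<i> * complex_of_real t * complex_of_real s)) * f s)"

text \<open>The \<open>n \<times> n\<close> matrix with entries \<open>M j k\<close> for \<open>j, k < n\<close>.  The quadratic form of a Hermitian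
  matrix is real, so only its real part needs to be constrained.\<close>

definition hermitian_psd :: "nat \<Rightarrow> (nat \<Rightarrow> nat \<Rightarrow> complex) \<Rightarrow> bool" where
  "hermitian_psd n M \<longleftrightarrow>
     (\<forall>j<n. \<forall>k<n. M j k = cnj (M k j)) \<and>
     (\<forall>c :: nat \<Rightarrow> complex. 0 \<le> Re (\<Sum>j<n. \<Sum>k<n. cnj (c j) * M j k * c k))"

definition positive_definite :: "(real \<Rightarrow> complex) \<Rightarrow> bool" where
  "positive_definite F \<longleftrightarrow>
     (\<forall>n\<ge>1. \<forall>t :: nat \<Rightarrow> real. hermitian_psd n (\<lambda>j k. F (t j - t k)))"

definition negative_definite :: "(real \<Rightarrow> complex) \<Rightarrow> bool" where
  "negative_definite H \<longleftrightarrow>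
     (\<forall>n\<ge>1. \<forall>t :: nat \<Rightarrow> real.
        hermitian_psd n (\<lambda>j k. H (t j) + cnj (H (t k)) - H (t j - t k)))"

text \<open>The library's \<^term>\<open>F analytic_on S\<close> is complex analyticity; this is analyticity of a function
  of a real variable: a convergent power series expansion around every point.\<close>

definition real_analytic :: "(real \<Rightarrow> complex) \<Rightarrow> bool" where
  "real_analytic F \<longleftrightarrow>
     (\<forall>x0. \<exists>r>0. \<exists>b :: nat \<Rightarrow> complex. \<forall>x. \<bar>x - x0\<bar> < r \<longrightarrow>
        (\<lambda>n. b n * complex_of_real (x - x0) ^ n) sums F x)"

end

theory Submission
  imports Defs "HOL-Complex_Analysis.Complex_Analysis" "HOL-Real_Asymp.Real_Asymp"
begin

text \<open>
  Substituting \<open>z = u\<^sup>2\<close> maps the right half plane onto the cut plane, and its boundary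
  covers both sides of the cut.  In the variable \<open>u\<close>, the function \<open>2 u (1 - G (u\<^sup>2))\<close> extends
  continuously to the closed half plane, because the factor \<open>u\<close> absorbs the logarithmic
  singularity at \<open>0\<close>.  Cauchy's formula on large half discs therefore needs no indentation of the
  contour, and, the boundary values at \<open>i v\<close> and \<open>- i v\<close> being conjugate, it turns into
  the Stieltjes representation \<open>1 - G z = \<integral> \<rho>(t) / (z + t) dt\<close>.  By Fubini, \<open>1 - G\<close> is then the Laplace
  transform of \<open>\<phi>\<close>.  Positivity of \<open>\<phi>\<close> holds although \<open>\<rho>\<close> changes sign: \<open>\<rho>\<close> is nonnegative up to some
  \<open>t\<^sub>0\<close> and nonpositive afterwards, so \<open>\<phi>(s) \<ge> exp (- s t\<^sub>0) \<integral> \<rho>\<close>, and \<open>\<integral> \<rho>\<close> is the limit of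
  \<open>x (1 - G x)\<close> for \<open>x \<rightarrow> \<infinity>\<close>, where \<open>G x \<le> 1\<close>.
\<close>

section \<open>Fourier transforms of nonnegative functions\<close>

text \<open>The disc of radius \<open>a\<close> about a point of the line lies in the right half
  plane, so the Taylor series converges there. Moving along the line multiplies the real increment
  by i, and the powers of i are absorbed into the coefficients.\<close>

lemma real_analytic_vertical_line:
  assumes "f holomorphic_on {z. 0 < Re z}" "0 < a"
  shows "real_analytic (\<lambda>t. f (of_real a + \<i> * of_real t))"
  unfolding real_analytic_def
proof (intro allI)
  fix x0 :: real
  define z where "z = of_real a + \<i> * of_real x0"
  have sub: "ball z a \<subseteq> {z. 0 < Re z}"
  proof
    fix w assume "w \<in> ball z a"
    then have "\<bar>Re (z - w)\<bar> < a" using abs_Re_le_cmod[of "z - w"] by (simp add: dist_norm)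
    then show "w \<in> {z. 0 < Re z}" by (simp add: z_def)
  qed
  have "(\<lambda>n. ((deriv ^^ n) f z / fact n * \<i> ^ n) * of_real (x - x0) ^ n) sums f (of_real a + \<i> * of_real x)"
    if "\<bar>x - x0\<bar> < a" for x
  proof -
    have d: "(of_real a + \<i> * of_real x) - z = \<i> * of_real (x - x0)"
      by (simp add: z_def algebra_simps)
    then have "dist (of_real a + \<i> * of_real x) z = \<bar>x - x0\<bar>"
      unfolding dist_norm by (simp add: norm_mult del: of_real_diff)
    then have "of_real a + \<i> * of_real x \<in> ball z a"
      using that by (simp add: dist_commute)
    from holomorphic_power_series[OF holomorphic_on_subset[OF assms(1) sub] this]
    show ?thesis by (simp add: d power_mult_distrib mult.assoc del: of_real_diff)
  qed
  then show "\<exists>r>0. \<exists>b. \<forall>x. \<bar>x - x0\<bar> < r \<longrightarrow>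
        (\<lambda>n. b n * complex_of_real (x - x0) ^ n) sums f (of_real a + \<i> * of_real x)"
    using assms(2) by (intro exI[of _ a] exI[of _ "\<lambda>n. (deriv ^^ n) f z / fact n * \<i> ^ n"] conjI allI impI) blast+
qed

lemma fourier_integrable:
  assumes "integrable lborel f"
  shows "integrable lborel (\<lambda>s. exp (- (\<i> * of_real t * of_real s)) * of_real (f s))"
proof (rule Bochner_Integration.integrable_bound[OF assms])
  have [measurable]: "f \<in> borel_measurable borel" using assms by simp
  show "(\<lambda>s. exp (- (\<i> * of_real t * of_real s)) * of_real (f s)) \<in> borel_measurable lborel"
    by measurable
qed (simp add: norm_mult)

text \<open>The quadratic form is the integral of \<open>f\<close> times the squared modulus of the
  sum of the \<open>cnj (c j) * g j\<close>. This serves both notions of definiteness: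
  \<open>g j\<close> is a character in the positive case and 1 minus a character in the negative
  case. The bound \<open>B\<close> makes the integrals converge.\<close>

lemma hermitian_psd_integral:
  fixes f :: "real \<Rightarrow> real"
  assumes "integrable lborel f" "\<And>s. 0 \<le> f s"
    and M: "\<And>j k. M j k = (LINT s|lborel. g j s * cnj (g k s) * of_real (f s))"
    and g: "\<And>j. g j \<in> borel_measurable borel" "\<And>j s. cmod (g j s) \<le> B"
  shows "hermitian_psd n M"
  unfolding hermitian_psd_def
proof (intro conjI allI impI)
  have int: "integrable lborel (\<lambda>s. g j s * cnj (g k s) * of_real (f s))" for j k
  proof (rule Bochner_Integration.integrable_bound)
    show "integrable lborel (\<lambda>s. B * B * f s)" by (intro integrable_mult_right assms(1))
    have [measurable]: "f \<in> borel_measurable borel" using assms(1) by simp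
    note g(1)[measurable]
    have [measurable]: "cnj \<in> borel_measurable borel" by (intro borel_measurable_continuous_onI continuous_intros)
    show "(\<lambda>s. g j s * cnj (g k s) * of_real (f s)) \<in> borel_measurable lborel"
      by measurable
    show "AE s in lborel. norm (g j s * cnj (g k s) * of_real (f s)) \<le> norm (B * B * f s)"
    proof (intro AE_I2)
      fix s
      have "0 \<le> B" using g(2)[of j s] norm_ge_zero order_trans by blast
      then show "norm (g j s * cnj (g k s) * of_real (f s)) \<le> norm (B * B * f s)"
        unfolding norm_mult by (intro mult_mono) (use g(2) in auto)
    qed
  qed
  show "M j k = cnj (M k j)" for j k
    unfolding M Bochner_Integration.integral_cnj[symmetric] by (intro Bochner_Integration.integral_cong) simp_all
  fix c :: "nat \<Rightarrow> complex"
  have "(\<Sum>j<n. \<Sum>k<n. cnj (c j) * M j k * c k) =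
     (\<Sum>j<n. \<Sum>k<n. LINT s|lborel. cnj (c j) * (g j s * cnj (g k s) * of_real (f s)) * c k)"
    unfolding M by simp
  also have "\<dots> = (LINT s|lborel. (\<Sum>j<n. \<Sum>k<n. cnj (c j) * (g j s * cnj (g k s) * of_real (f s)) * c k))"
    using int by (simp add: Bochner_Integration.integral_sum)
  also have "\<dots> = (LINT s|lborel. of_real ((cmod (\<Sum>j<n. cnj (c j) * g j s))\<^sup>2 * f s))"
  proof (intro Bochner_Integration.integral_cong refl)
    fix s
    have "(\<Sum>j<n. \<Sum>k<n. cnj (c j) * (g j s * cnj (g k s) * of_real (f s)) * c k)
      = (\<Sum>j<n. cnj (c j) * g j s) * (\<Sum>k<n. c k * cnj (g k s)) * of_real (f s)"
      by (simp add: sum_product sum_distrib_right sum_distrib_left mult_ac)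
    also have "(\<Sum>k<n. c k * cnj (g k s)) = cnj (\<Sum>j<n. cnj (c j) * g j s)" by simp
    finally show "(\<Sum>j<n. \<Sum>k<n. cnj (c j) * (g j s * cnj (g k s) * of_real (f s)) * c k) =
        of_real ((cmod (\<Sum>j<n. cnj (c j) * g j s))\<^sup>2 * f s)"
      unfolding of_real_mult complex_norm_square .
  qed
  also have "\<dots> = of_real (LINT s|lborel. (cmod (\<Sum>j<n. cnj (c j) * g j s))\<^sup>2 * f s)"
    by (rule integral_complex_of_real)
  finally show "0 \<le> Re (\<Sum>j<n. \<Sum>k<n. cnj (c j) * M j k * c k)"
    using assms(2) by (metis (no_types, lifting) Re_complex_of_real integral_nonneg_AE AE_I2 mult_nonneg_nonneg zero_le_power2)
qed

lemma positive_definite_fourier: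
  assumes "integrable lborel f" "\<And>s. 0 \<le> f s"
  shows "positive_definite (fourier_transform (\<lambda>s. of_real (f s)))"
  unfolding positive_definite_def
proof (intro allI impI)
  fix n :: nat and t :: "nat \<Rightarrow> real"
  show "hermitian_psd n (\<lambda>j k. fourier_transform (\<lambda>s. of_real (f s)) (t j - t k))"
  proof (rule hermitian_psd_integral[OF assms, where B = 1])
    show "fourier_transform (\<lambda>s. of_real (f s)) (t j - t k) =
      (LINT s|lborel. exp (- (\<i> * of_real (t j) * of_real s)) *
          cnj (exp (- (\<i> * of_real (t k) * of_real s))) * of_real (f s))" for j k
      unfolding fourier_transform_def by (simp add: exp_cnj exp_add[symmetric] algebra_simps)
  qed (auto intro!: borel_measurable_continuous_onI continuous_intros)
qed

text \<open>With e, e' the characters at \<open>t j\<close>, \<open>t k\<close>, the kernel factors: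
  (1 - e) + (1 - cnj e') - (1 - e * cnj e') = (1 - e) * cnj (1 - e'). The constant \<open>b\<close>
  leaves room for the value of \<open>G\<close> at \<open>a\<close>.\<close>

lemma negative_definite_fourier:
  assumes f: "integrable lborel f" "\<And>s. 0 \<le> f s" and "0 \<le> b"
  defines "F \<equiv> fourier_transform (\<lambda>s. of_real (f s))"
  shows "negative_definite (\<lambda>t. of_real b + (F 0 - F t))"
  unfolding negative_definite_def
proof (intro allI impI)
  fix n :: nat and t :: "nat \<Rightarrow> real"
  let ?e = "\<lambda>t s. exp (- (\<i> * of_real t * of_real s)) :: complex"
  have F: "F 0 - F x = (LINT s|lborel. (1 - ?e x s) * of_real (f s))" for x
    unfolding F_def fourier_transform_def
    using fourier_integrable[OF f(1), of x] fourier_integrable[OF f(1), of 0]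
    by (subst Bochner_Integration.integral_diff[symmetric]) (simp_all add: left_diff_distrib)
  have int: "integrable lborel (\<lambda>s. (1 - ?e x s) * of_real (f s))" for x
    using fourier_integrable[OF f(1)] fourier_integrable[OF f(1), of 0]
    by (simp add: left_diff_distrib)
  have int': "integrable lborel (\<lambda>s. (1 - cnj (?e x s)) * of_real (f s))" for x
    using int[of "-x"] by (simp add: exp_cnj)
  have H: "hermitian_psd n (\<lambda>j k. (F 0 - F (t j)) + cnj (F 0 - F (t k)) - (F 0 - F (t j - t k)))"
  proof (rule hermitian_psd_integral[OF f, where B = 2 and g = "\<lambda>j s. 1 - ?e (t j) s"])
    fix j k
    have "cnj (F 0 - F (t k)) = (LINT s|lborel. (1 - cnj (?e (t k) s)) * of_real (f s))"
      unfolding F Bochner_Integration.integral_cnj[symmetric] by simp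
    then have "(F 0 - F (t j)) + cnj (F 0 - F (t k)) - (F 0 - F (t j - t k)) =
      (LINT s|lborel. (1 - ?e (t j) s) * of_real (f s) + (1 - cnj (?e (t k) s)) * of_real (f s)
          - (1 - ?e (t j - t k) s) * of_real (f s))"
      unfolding F using int[of "t j"] int'[of "t k"] int[of "t j - t k"]
      by (simp del: of_real_diff)
    also have "\<dots> = (LINT s|lborel. (1 - ?e (t j) s) * cnj (1 - ?e (t k) s) * of_real (f s))"
    proof (intro Bochner_Integration.integral_cong refl)
      fix s
      have "?e (t j - t k) s = ?e (t j) s * cnj (?e (t k) s)"
        by (simp add: exp_cnj exp_add[symmetric] algebra_simps)
      then show "(1 - ?e (t j) s) * of_real (f s) + (1 - cnj (?e (t k) s)) * of_real (f s)
          - (1 - ?e (t j - t k) s) * of_real (f s) = (1 - ?e (t j) s) * cnj (1 - ?e (t k) s) * of_real (f s)"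
        by (simp add: algebra_simps)
    qed
    finally show "(F 0 - F (t j)) + cnj (F 0 - F (t k)) - (F 0 - F (t j - t k)) = \<dots>" .
  next
    show "cmod (1 - ?e (t j) s) \<le> 2" for j s
      by (rule order_trans[OF norm_triangle_ineq4]) simp
  qed (auto intro!: borel_measurable_continuous_onI continuous_intros)
  \<comment> \<open>The constant adds b + b - b = b to every entry, hence \<open>b\<close> times the
    squared modulus of the sum of the \<open>c k\<close> to the quadratic form.\<close>
  show "hermitian_psd n (\<lambda>j k. of_real b + (F 0 - F (t j)) + cnj (of_real b + (F 0 - F (t k)))
           - (of_real b + (F 0 - F (t j - t k))))"
    unfolding hermitian_psd_def
  proof (intro conjI allI impI)
    fix j k assume "j < n" "k < n"
    then have "(F 0 - F (t j)) + cnj (F 0 - F (t k)) - (F 0 - F (t j - t k)) =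
       cnj ((F 0 - F (t k)) + cnj (F 0 - F (t j)) - (F 0 - F (t k - t j)))"
      using H unfolding hermitian_psd_def by blast
    then show "of_real b + (F 0 - F (t j)) + cnj (of_real b + (F 0 - F (t k)))
           - (of_real b + (F 0 - F (t j - t k))) = cnj (of_real b + (F 0 - F (t k)) + cnj (of_real b + (F 0 - F (t j)))
           - (of_real b + (F 0 - F (t k - t j))))"
      by (simp add: algebra_simps)
  next
    fix c :: "nat \<Rightarrow> complex"
    let ?M = "\<lambda>j k. (F 0 - F (t j)) + cnj (F 0 - F (t k)) - (F 0 - F (t j - t k))"
    have "(\<Sum>j<n. \<Sum>k<n. cnj (c j) * (of_real b + (F 0 - F (t j)) + cnj (of_real b + (F 0 - F (t k)))
           - (of_real b + (F 0 - F (t j - t k)))) * c k) =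
         (\<Sum>j<n. \<Sum>k<n. cnj (c j) * ?M j k * c k + of_real b * (cnj (c j) * c k))"
      by (intro sum.cong refl) (simp add: algebra_simps)
    also have "\<dots> = (\<Sum>j<n. \<Sum>k<n. cnj (c j) * ?M j k * c k) + of_real b * (cnj (\<Sum>k<n. c k) * (\<Sum>k<n. c k))"
      unfolding cnj_sum sum_product by (simp add: sum.distrib sum_distrib_left)
    also have "cnj (\<Sum>k<n. c k) * (\<Sum>k<n. c k) = of_real ((cmod (\<Sum>k<n. c k))\<^sup>2)"
      unfolding complex_norm_square by (rule mult.commute)
    finally have *: "(\<Sum>j<n. \<Sum>k<n. cnj (c j) * (of_real b + (F 0 - F (t j)) + cnj (of_real b + (F 0 - F (t k)))
           - (of_real b + (F 0 - F (t j - t k)))) * c k) =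
       (\<Sum>j<n. \<Sum>k<n. cnj (c j) * ?M j k * c k) + of_real b * of_real ((cmod (\<Sum>k<n. c k))\<^sup>2)" .
    show "0 \<le> Re (\<Sum>j<n. \<Sum>k<n. cnj (c j) * (of_real b + (F 0 - F (t j)) + cnj (of_real b + (F 0 - F (t k)))
           - (of_real b + (F 0 - F (t j - t k)))) * c k)"
      unfolding *
    proof -
      have "0 \<le> Re (\<Sum>j<n. \<Sum>k<n. cnj (c j) * ?M j k * c k)"
        using H unfolding hermitian_psd_def by blast
      moreover have "0 \<le> b * (cmod (\<Sum>k<n. c k))\<^sup>2" using \<open>0 \<le> b\<close> by simp
      ultimately show "0 \<le> Re ((\<Sum>j<n. \<Sum>k<n. cnj (c j) * ?M j k * c k) + of_real b * of_real ((cmod (\<Sum>k<n. c k))\<^sup>2))"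
        unfolding of_real_mult[symmetric] plus_complex.sel Re_complex_of_real by linarith
    qed
  qed
qed

text \<open>For n = 1 the single matrix entry is twice the real part of \<open>H t\<close>, because
  \<open>H 0\<close> vanishes.\<close>

lemma Re_negative_definite_nonneg:
  assumes "negative_definite H" "H 0 = 0"
  shows "0 \<le> Re (H t)"
proof -
  have "hermitian_psd 1 (\<lambda>j k. H t + cnj (H t) - H (t - t))"
    using assms(1)[unfolded negative_definite_def, rule_format, of 1 "\<lambda>_. t"] by simp
  then have "\<forall>c::nat \<Rightarrow> complex. 0 \<le> Re (cnj (c 0) * (H t + cnj (H t)) * c 0)"
    by (simp add: hermitian_psd_def assms(2))
  from spec[OF this, of "\<lambda>_. 1"] show ?thesis by simp
qed

section \<open>Cauchy's integral formula for the right half plane\<close>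

lemma exp_half_pi_ii:
  "exp (\<i> * of_real pi / 2) = \<i>" "exp (- (\<i> * of_real pi / 2)) = - \<i>"
  using cis_conv_exp[of "pi/2"] cis_conv_exp[of "-(pi/2)"] by simp_all

text \<open>Seen from \<open>z\<close>, the arc and the diameter both turn counterclockwise, so each
  has a winding number with positive real part. A simple closed path whose winding number has
  positive real part has winding number 1.\<close>

lemma winding_number_half_disc:
  fixes z :: complex
  assumes "0 < Re z" "cmod z < R"
  defines "\<gamma> \<equiv> part_circlepath 0 R (- (pi/2)) (pi/2) +++ linepath (\<i> * R) (- (\<i> * R))"
  shows "winding_number \<gamma> z = 1" "z \<notin> path_image \<gamma>"
proof -
  define g where "g = part_circlepath 0 R (- (pi/2)) (pi/2)"
  define l where "l = linepath (\<i> * R) (- (\<i> * R))"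
  have R: "R > 0" using assms(2) norm_ge_zero[of z] by linarith
  have ends: "pathstart g = - (\<i> * R)" "pathfinish g = \<i> * R"
    by (simp_all add: g_def exp_half_pi_ii)
  have img_g: "path_image g \<subseteq> sphere 0 R"
    unfolding g_def using R by (intro path_image_part_circlepath_subset) auto
  have img_l: "path_image l \<subseteq> {w. Re w = 0}"
    by (auto simp: l_def closed_segment_same_Re)
  have pos: "valid_path (g +++ l) \<and> z \<notin> path_image (g +++ l) \<and> 0 < Re (winding_number (g +++ l) z)"
  proof (rule winding_number_join_pos_combined)
    show "0 < Re (winding_number g z)"
      unfolding g_def by (rule winding_number_part_circlepath_pos_less) (use assms in auto)
    show "0 < Re (winding_number l z)"
      unfolding l_def by (rule winding_number_linepath_pos_lt) (use assms R in \<open>simp add: algebra_simps\<close>)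
  qed (use assms img_g img_l ends in \<open>auto simp: g_def l_def\<close>)
  have "simple_path (g +++ l)"
  proof (rule simple_path_join_loop)
    show "arc g" unfolding g_def using R by (intro arc_part_circlepath) auto
    show "arc l" unfolding l_def using R by (intro arc_linepath) (auto simp: complex_eq_iff)
    \<comment> \<open>A point of modulus R on the imaginary axis is one of the two common
      endpoints.\<close>
    show "path_image g \<inter> path_image l \<subseteq> {pathstart g, pathstart l}"
    proof
      fix w assume w: "w \<in> path_image g \<inter> path_image l"
      then have "cmod w = R" "Re w = 0" using img_g img_l by auto
      then have "\<bar>Im w\<bar> = R" by (simp add: cmod_def)
      then show "w \<in> {pathstart g, pathstart l}"
        using ends(1) \<open>Re w = 0\<close> by (auto simp: l_def complex_eq_iff abs_if split: if_splits)
    qed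
  qed (use ends in \<open>auto simp: l_def\<close>)
  then have "winding_number (g +++ l) z = 1"
    using pos ends by (intro simple_closed_path_winding_number_pos) (auto simp: l_def)
  then show "winding_number \<gamma> z = 1" "z \<notin> path_image \<gamma>"
    using pos by (auto simp: \<gamma>_def g_def l_def)
qed

text \<open>Cauchy's formula on the half disc of radius R. On the arc the kernel is of order 1/R and
  the length is of order R, so the arc contribution is controlled by the supremum of
  \<open>f\<close> there, and no rate of decay is required.\<close>

lemma Cauchy_integral_right_half_plane:
  fixes f :: "complex \<Rightarrow> complex"
  assumes cont: "continuous_on {w. 0 \<le> Re w} f"
    and holo: "f holomorphic_on {w. 0 < Re w}"
    and lim: "(f \<longlongrightarrow> 0) (inf at_infinity (principal {w. 0 \<le> Re w}))"
    and z: "0 < Re z"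
  shows "((\<lambda>R. integral {-R..R} (\<lambda>v. f (\<i> * of_real v) / (z - \<i> * of_real v)))
           \<longlongrightarrow> 2 * pi * f z) at_top"
proof -
  define I where "I R = integral {-R..R} (\<lambda>v. f (\<i> * of_real v) / (z - \<i> * of_real v))" for R
  have "((\<lambda>R. I R - 2 * pi * f z) \<longlongrightarrow> 0) at_top"
  proof (rule tendstoI)
    fix e :: real assume e: "e > 0"
    \<comment> \<open>The arc will contribute at most \<open>2 * pi * d\<close>, which is below
      \<open>8 * d = e\<close>.\<close>
    define d where "d = e / 8"
    have d: "d > 0" using e by (simp add: d_def)
    have "eventually (\<lambda>w. dist (f w) 0 < d) (inf at_infinity (principal {w. 0 \<le> Re w}))"
      using lim d by (rule tendstoD)
    then obtain b where b: "\<And>w. cmod w \<ge> b \<Longrightarrow> 0 \<le> Re w \<Longrightarrow> cmod (f w) < d"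
      unfolding eventually_inf_principal eventually_at_infinity by auto
    \<comment> \<open>\<open>R \<ge> b\<close> makes \<open>f\<close> small on the arc;
      \<open>R \<ge> 2 * cmod z + 1\<close> keeps the arc at distance at least \<open>R / 2\<close>
      from \<open>z\<close>.\<close>
    have "dist (I R - 2 * pi * f z) 0 < e" if "R \<ge> max b (2 * cmod z + 1)" for R
    proof -
      define g where "g = part_circlepath 0 R (- (pi/2)) (pi/2)"
      define l where "l = linepath (\<i> * R) (- (\<i> * R))"
      have Rb: "R \<ge> b" "R \<ge> 2 * cmod z + 1" using that by auto
      have R: "R > 0" "cmod z < R" using Rb(2) norm_ge_zero[of z] by linarith+
      have ends: "pathstart g = - (\<i> * R)" "pathfinish g = \<i> * R"
        by (simp_all add: g_def exp_half_pi_ii)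
      note wn = winding_number_half_disc[OF z R(2), folded g_def l_def]
      define S where "S = {w. 0 \<le> Re w}"
      have half: "S = {w. 0 \<le> (1::complex) \<bullet> w}" by (simp add: S_def)
      have convS: "convex S" unfolding S_def by (rule convex_halfspace_Re_ge)
      have intS: "interior S = {w. 0 < Re w}"
        unfolding half using interior_halfspace_ge[of "1::complex" 0] by simp
      have img_g: "path_image g \<subseteq> S"
      proof
        fix w assume "w \<in> path_image g"
        then obtain x where x: "x \<in> closed_segment (-(pi/2)) (pi/2)" "w = R * cis x"
          by (auto simp: g_def path_image_part_circlepath' cis_conv_exp)
        then have "cos x \<ge> 0" by (intro cos_ge_zero) (auto simp: closed_segment_eq_real_ivl)
        then show "w \<in> S" using x R by (simp add: S_def)
      qed
      have norm_g: "cmod w = R" if "w \<in> path_image g" for w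
        using that R path_image_part_circlepath_subset[of "-(pi/2)" "pi/2" R 0] by (auto simp: g_def)
      have img_l: "path_image l \<subseteq> S"
        by (auto simp: l_def closed_segment_same_Re S_def)
      have C: "((\<lambda>w. f w / (w - z)) has_contour_integral (2 * pi * \<i> * winding_number (g +++ l) z * f z)) (g +++ l)"
      \<comment> \<open>The weak form asks for differentiability in the interior only, so continuity
        of \<open>f\<close> on the imaginary axis is enough.\<close>
      proof (rule Cauchy_integral_formula_weak[where S = S and k = "{}"])
        show "f field_differentiable at x" if "x \<in> interior S - {}" for x
          using that holo holomorphic_on_imp_differentiable_at[OF holo open_halfspace_Re_gt]
          by (auto simp: intS)
        show "valid_path (g +++ l)" using ends by (intro valid_path_join) (auto simp: g_def l_def)
        show "path_image (g +++ l) \<subseteq> S - {z}"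
          using wn(2) img_g img_l ends by (subst path_image_join) (auto simp: l_def path_image_join)
      qed (use cont z convS intS ends in \<open>auto simp: S_def l_def\<close>)
      have cont': "continuous_on T (\<lambda>w. f w / (w - z))" if "T \<subseteq> path_image (g +++ l)" for T
        using that wn(2) img_g img_l ends
        by (intro continuous_intros continuous_on_subset[OF cont])
           (auto simp: path_image_join l_def S_def)
      have ig: "(\<lambda>w. f w / (w - z)) contour_integrable_on g"
        unfolding g_def by (intro contour_integrable_continuous_part_circlepath cont', fold g_def)
          (use ends in \<open>simp add: path_image_join l_def\<close>)
      have il: "(\<lambda>w. f w / (w - z)) contour_integrable_on l"
        unfolding l_def by (intro contour_integrable_continuous_linepath cont')
          (use ends in \<open>simp add: path_image_join l_def\<close>)
      have sum: "2 * pi * \<i> * f z = contour_integral g (\<lambda>w. f w / (w - z)) + contour_integral l (\<lambda>w. f w / (w - z))"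
        using contour_integral_unique[OF C] wn(1) ig il ends
        by (subst (asm) contour_integral_join) (auto simp: g_def l_def)
      have "cmod (contour_integral g (\<lambda>w. f w / (w - z))) \<le> (2 * d / R) * R * (pi/2 - -(pi/2))"
      proof (rule has_contour_integral_bound_part_circlepath)
        show "((\<lambda>w. f w / (w - z)) has_contour_integral contour_integral g (\<lambda>w. f w / (w - z)))
                (part_circlepath 0 R (- (pi/2)) (pi/2))"
          using ig has_contour_integral_integral by (auto simp: g_def)
        show "cmod (f x / (x - z)) \<le> 2 * d / R"
          if "x \<in> path_image (part_circlepath 0 R (- (pi/2)) (pi/2))" for x
        proof -
          have x: "cmod x = R" "0 \<le> Re x"
            using that norm_g img_g by (auto simp: g_def S_def)
          have "cmod (x - z) \<ge> R - cmod z" using norm_triangle_ineq2[of x z] x by simp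
          then have "cmod (x - z) \<ge> R / 2" using Rb by linarith
          moreover have "cmod (f x) \<le> d" using b[of x] x Rb by auto
          ultimately have "cmod (f x) / cmod (x - z) \<le> d / (R/2)"
            using R d by (intro frac_le) auto
          then show ?thesis by (simp add: norm_divide mult.commute)
        qed
      qed (use R d in auto)
      also have "\<dots> = 2 * pi * d" using R by simp
      finally have bound: "cmod (contour_integral g (\<lambda>w. f w / (w - z))) \<le> 2 * pi * d" .
      \<comment> \<open>The sign from the downward orientation of \<open>l\<close> cancels the sign
        from writing \<open>z - w\<close> for \<open>w - z\<close>; the factor i is the derivative
        of the parametrization.\<close>
      have line: "contour_integral l (\<lambda>w. f w / (w - z)) = \<i> * I R"
      proof -
        have "contour_integral l (\<lambda>w. f w / (w - z)) =
            - contour_integral (linepath (- (\<i> * R)) (\<i> * R)) (\<lambda>w. f w / (w - z))"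
          unfolding l_def by (intro contour_integral_reverse_linepath cont')
            (use ends in \<open>simp add: path_image_join l_def\<close>)
        also have "\<dots> = - (\<i> * integral {-R..R} (\<lambda>v. f (Complex 0 v) / (Complex 0 v - z)))"
          using R by (subst contour_integral_linepath_same_Re[of _ 0 _ "-R" R]) auto
        also have "(\<lambda>v. f (Complex 0 v) / (Complex 0 v - z)) = (\<lambda>v. - (f (\<i> * of_real v) / (z - \<i> * of_real v)))"
          by (simp add: Complex_eq flip: divide_minus_right)
        finally show ?thesis unfolding I_def by simp
      qed
      have "\<i> * (I R - 2 * pi * f z) = - contour_integral g (\<lambda>w. f w / (w - z))"
        using sum line by (simp add: algebra_simps)
      then have "cmod (I R - 2 * pi * f z) = cmod (contour_integral g (\<lambda>w. f w / (w - z)))"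
        by (metis norm_ii norm_minus_cancel norm_mult mult_1)
      also have "\<dots> \<le> 2 * pi * d" by (rule bound)
      also have "\<dots> < 8 * d" using d pi_less_4 by simp
      finally show ?thesis by (simp add: d_def)
    qed
    then show "eventually (\<lambda>R. dist (I R - 2 * pi * f z) 0 < e) at_top"
      by (intro eventually_at_top_linorderI)
  qed
  then show ?thesis by (simp add: I_def LIM_zero_iff)
qed

section \<open>The function \<open>G\<close> in the variable \<open>u = \<surd>z\<close>\<close>

text \<open>On the closed right half plane, \<open>Lsq u\<close> continues \<^term>\<open>Ln (1 + u\<^sup>2)\<close> continuously from the
  interior to the boundary; \<open>Lsq_inv\<close> has its limit value at the logarithmic poles \<open>\<plusminus> i\<close> of \<open>Lsq\<close>.\<close>

definition Lsq :: "complex \<Rightarrow> complex" where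
  "Lsq u = Ln (u + \<i>) + Ln (u - \<i>)"

definition Lsq_inv :: "complex \<Rightarrow> complex" where
  "Lsq_inv u = (if u = \<i> \<or> u = - \<i> then 0 else inverse (Lsq u))"

text \<open>On the open right half plane this is \<open>G (u\<^sup>2)\<close>. On the positive and
  negative imaginary axis it gives the limits of \<open>G\<close> at the cut from above and from
  below.\<close>

definition Gsq :: "complex \<Rightarrow> complex" where
  "Gsq u = (1 - 2 * Ln u * Lsq_inv u) * u\<^sup>2 * (2 * Ln u)"

lemma exp_Lsq: "u \<noteq> \<i> \<Longrightarrow> u \<noteq> - \<i> \<Longrightarrow> exp (Lsq u) = 1 + u\<^sup>2"
  by (simp add: Lsq_def exp_add eq_neg_iff_add_eq_0 power2_eq_square algebra_simps)

lemma Lsq_nonzero: "u \<noteq> 0 \<Longrightarrow> u \<noteq> \<i> \<Longrightarrow> u \<noteq> - \<i> \<Longrightarrow> Lsq u \<noteq> 0"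
  using exp_Lsq[of u] by auto

text \<open>The argument of u is below pi/2 in modulus, so doubling it stays within the principal
  branch.\<close>

lemma Ln_power2_right_half_plane:
  assumes "0 < Re u" shows "Ln (u\<^sup>2) = 2 * Ln u"
proof -
  have "u \<noteq> 0" using assms by auto
  moreover have "\<bar>Im (Ln u)\<bar> < pi/2" using assms Re_Ln_pos_lt[of u] \<open>u \<noteq> 0\<close> by blast
  ultimately show ?thesis
    unfolding power2_eq_square by (subst Ln_times_simple) (auto simp: abs_less_iff)
qed

text \<open>The arguments of u + i and u - i have a sum strictly between -pi and pi: for Re u > 0
  both are below pi/2 in modulus, and in the unit disc they have opposite signs. The disc case
  covers the imaginary axis between the poles and a full neighbourhood of 0.\<close>

lemma Lsq_eq_Ln:
  assumes "0 < Re u \<or> cmod u < 1"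
  shows "Lsq u = Ln (1 + u\<^sup>2)"
proof -
  have ne: "u + \<i> \<noteq> 0" "u - \<i> \<noteq> 0"
    using assms by (auto simp: eq_neg_iff_add_eq_0[symmetric])
  have "- pi < Im (Ln (u + \<i>)) + Im (Ln (u - \<i>)) \<and> Im (Ln (u + \<i>)) + Im (Ln (u - \<i>)) < pi"
  proof (cases "0 < Re u")
    case True
    then have "\<bar>Im (Ln (u + \<i>))\<bar> < pi/2" "\<bar>Im (Ln (u - \<i>))\<bar> < pi/2"
      using Re_Ln_pos_lt ne by auto
    then show ?thesis by linarith
  next
    case False
    then have "\<bar>Im u\<bar> < 1" using assms abs_Im_le_cmod[of u] by linarith
    then have "0 < Im (u + \<i>)" "Im (u - \<i>) < 0" by auto
    then have "0 < Im (Ln (u + \<i>))" "Im (Ln (u + \<i>)) < pi" "\<not> 0 \<le> Im (Ln (u - \<i>))" "- pi < Im (Ln (u - \<i>))"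
      using Im_Ln_pos_lt[OF ne(1)] Im_Ln_pos_le[OF ne(2)] Im_Ln_le_pi mpi_less_Im_Ln ne
        by (blast, blast, (metis linorder_not_le Im_Ln_le_pi), blast)
    then show ?thesis by linarith
  qed
  then have "Ln ((u + \<i>) * (u - \<i>)) = Lsq u"
    unfolding Lsq_def using ne by (intro Ln_times_simple) auto
  moreover have "(u + \<i>) * (u - \<i>) = 1 + u\<^sup>2" by (simp add: algebra_simps power2_eq_square)
  ultimately show ?thesis by simp
qed

lemma Gsq_eq_G:
  assumes "0 < Re u" shows "Gsq u = G (u\<^sup>2)"
proof -
  have "u \<noteq> \<i>" "u \<noteq> - \<i>" using assms by auto
  then have "Lsq_inv u = inverse (Ln (1 + u\<^sup>2))"
    using Lsq_eq_Ln[of u] assms by (simp add: Lsq_inv_def)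
  then show ?thesis
    unfolding Gsq_def G_def Ln_power2_right_half_plane[OF assms] by (simp only: divide_inverse)
qed

text \<open>The modulus of \<open>Lsq u\<close> is at least that of its real part, the logarithm of
  |1 + u^2|, which is unbounded near the poles. The real part ignores branches, so the limit may be
  taken over a full punctured neighbourhood.\<close>

lemma Lsq_inv_tendsto_0:
  assumes "c = \<i> \<or> c = - \<i>"
  shows "(Lsq_inv \<longlongrightarrow> 0) (at c)"
proof -
  have 1: "filterlim (\<lambda>u. ln (cmod (1 + u\<^sup>2))) at_bot (at c)"
  proof (rule filterlim_compose[OF ln_at_0])
    have "1 + c\<^sup>2 = 0" using assms by auto
    then have "((\<lambda>u. cmod (1 + u\<^sup>2)) \<longlongrightarrow> 0) (at c)"
      by (auto intro!: tendsto_eq_intros)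
    moreover have "eventually (\<lambda>u. u \<notin> {\<i>, - \<i>}) (at c)"
      by (auto intro!: eventually_conj eventually_neq_at_within)
    ultimately show "filterlim (\<lambda>u. cmod (1 + u\<^sup>2)) (at_right 0) (at c)"
      unfolding filterlim_at
    proof (intro conjI)
      assume "eventually (\<lambda>u. u \<notin> {\<i>, - \<i>}) (at c)"
      then show "eventually (\<lambda>u. cmod (1 + u\<^sup>2) \<in> {0<..} \<and> cmod (1 + u\<^sup>2) \<noteq> 0) (at c)"
      proof eventually_elim
        case (elim u)
        have "1 + u\<^sup>2 \<noteq> 0" using exp_Lsq[of u] elim by (metis exp_not_eq_zero insert_iff)
        then show ?case by simp
      qed
    qed
  qed
  have "filterlim (\<lambda>u. - ln (cmod (1 + u\<^sup>2))) at_top (at c)"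
    using 1 by (simp add: filterlim_uminus_at_top)
  then have "filterlim (\<lambda>u. norm (Lsq u)) at_top (at c)"
  proof (rule filterlim_at_top_mono)
    have "eventually (\<lambda>u. u \<notin> {\<i>, - \<i>}) (at c)"
      by (auto intro!: eventually_conj eventually_neq_at_within)
    then show "eventually (\<lambda>u. - ln (cmod (1 + u\<^sup>2)) \<le> norm (Lsq u)) (at c)"
    proof eventually_elim
      case (elim u)
      then have "ln (cmod (1 + u\<^sup>2)) = Re (Lsq u)"
        using exp_Lsq[of u] norm_exp_eq_Re[of "Lsq u"] by (simp flip: exp_Lsq)
      then show ?case using abs_Re_le_cmod[of "Lsq u"] by linarith
    qed
  qed
  then have 2: "filterlim Lsq at_infinity (at c)"
    by (rule filterlim_norm_at_top_imp_at_infinity)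
  have "((\<lambda>u. inverse (Lsq u)) \<longlongrightarrow> 0) (at c)"
    using 2 tendsto_inverse_0 filterlim_compose by blast
  then show ?thesis
  proof (rule Lim_transform_eventually)
    have "eventually (\<lambda>u. u \<notin> {\<i>, - \<i>}) (at c)"
      by (auto intro!: eventually_conj eventually_neq_at_within)
    then show "eventually (\<lambda>u. inverse (Lsq u) = Lsq_inv u) (at c)"
      by eventually_elim (auto simp: Lsq_inv_def)
  qed
qed

text \<open>Away from the poles, u + i and u - i avoid the cut of \<open>Ln\<close> even when u is
  imaginary. The origin is excluded because \<open>Lsq\<close> vanishes there.\<close>

lemma continuous_within_Lsq_inv:
  assumes "0 \<le> Re u" "u \<noteq> 0"
  shows "continuous (at u within {w. 0 \<le> Re w}) Lsq_inv"
proof (cases "u = \<i> \<or> u = - \<i>")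
  case True
  then have "Lsq_inv u = 0" by (simp add: Lsq_inv_def)
  then show ?thesis
    unfolding continuous_within using Lsq_inv_tendsto_0[OF True] by (metis tendsto_within_subset subset_UNIV)
next
  case False
  have "u + \<i> \<notin> \<real>\<^sub>\<le>\<^sub>0" "u - \<i> \<notin> \<real>\<^sub>\<le>\<^sub>0"
    using assms False by (auto simp: complex_nonpos_Reals_iff complex_eq_iff)
  moreover have "Lsq u \<noteq> 0" using Lsq_nonzero assms False by auto
  ultimately have "isCont (\<lambda>u. inverse (Ln (u + \<i>) + Ln (u - \<i>))) u"
    by (intro continuous_intros) (auto simp: Lsq_def)
  moreover have "eventually (\<lambda>w. Lsq_inv w = inverse (Ln (w + \<i>) + Ln (w - \<i>))) (nhds u)"
  proof -
    have "eventually (\<lambda>w. w \<in> - {\<i>, - \<i>}) (nhds u)"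
      using False by (intro eventually_nhds_in_open) auto
    then show ?thesis by eventually_elim (auto simp: Lsq_inv_def Lsq_def)
  qed
  ultimately have "isCont Lsq_inv u" by (simp add: isCont_cong)
  then show ?thesis by (rule continuous_at_imp_continuous_at_within)
qed

section \<open>Behaviour at the origin\<close>

lemma Ln_add_one_over_tendsto_1: "((\<lambda>p. Ln (1 + p) / p) \<longlongrightarrow> 1) (at 0)"
proof -
  have "(Ln has_field_derivative inverse 1) (at 1)"
    by (rule has_field_derivative_Ln) auto
  then show ?thesis by (simp add: DERIV_def)
qed

lemma filterlim_cmod_at_0: "filterlim cmod (at_right 0) (at 0)"
  unfolding filterlim_at
  by (auto intro!: tendsto_norm_zero tendsto_ident_at eventually_neq_at_within
      simp: eventually_at_filter)

lemma norm_Ln_le: "u \<noteq> 0 \<Longrightarrow> cmod (Ln u) \<le> \<bar>ln (cmod u)\<bar> + pi"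
  using cmod_le[of "Ln u"] mpi_less_Im_Ln[of u] Im_Ln_le_pi[of u] by simp

text \<open>Powers of |u| beat the logarithm. Since \<open>norm_Ln_le\<close> bounds the argument by
  pi, the jump of \<open>Ln\<close> across its cut does not disturb the full limit at 0.\<close>

lemma power_Ln_tendsto_0:
  "((\<lambda>u. u * (Ln u)\<^sup>2) \<longlongrightarrow> 0) (at 0)" "((\<lambda>u. u ^ 3 * Ln u) \<longlongrightarrow> 0) (at 0)"
proof -
  have ne: "eventually (\<lambda>u. u \<noteq> (0::complex)) (at 0)" by (rule eventually_neq_at_within)
  have "((\<lambda>x::real. x * (\<bar>ln x\<bar> + pi)\<^sup>2) \<longlongrightarrow> 0) (at_right 0)" by real_asymp
  from filterlim_compose[OF this filterlim_cmod_at_0]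
  have "((\<lambda>u. cmod u * (\<bar>ln (cmod u)\<bar> + pi)\<^sup>2) \<longlongrightarrow> 0) (at 0)" .
  moreover have "eventually (\<lambda>u. norm (u * (Ln u)\<^sup>2) \<le> cmod u * (\<bar>ln (cmod u)\<bar> + pi)\<^sup>2) (at 0)"
    using ne by eventually_elim (auto simp: norm_mult norm_power intro!: mult_left_mono power_mono norm_Ln_le)
  ultimately show "((\<lambda>u. u * (Ln u)\<^sup>2) \<longlongrightarrow> 0) (at 0)" by (rule Lim_null_comparison[rotated])
  have "((\<lambda>x::real. x ^ 3 * (\<bar>ln x\<bar> + pi)) \<longlongrightarrow> 0) (at_right 0)" by real_asymp
  from filterlim_compose[OF this filterlim_cmod_at_0]
  have "((\<lambda>u. cmod u ^ 3 * (\<bar>ln (cmod u)\<bar> + pi)) \<longlongrightarrow> 0) (at 0)" .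
  moreover have "eventually (\<lambda>u. norm (u ^ 3 * Ln u) \<le> cmod u ^ 3 * (\<bar>ln (cmod u)\<bar> + pi)) (at 0)"
    using ne by eventually_elim (auto simp: norm_mult norm_power intro!: mult_left_mono power_mono norm_Ln_le)
  ultimately show "((\<lambda>u. u ^ 3 * Ln u) \<longlongrightarrow> 0) (at 0)" by (rule Lim_null_comparison[rotated])
qed

text \<open>Near 0, \<open>Ln (1 + u\<^sup>2)\<close> behaves like u^2, so dividing by it costs two
  powers of u. The worst remaining term is of the size of \<open>u * (Ln u)\<^sup>2\<close>, which
  still tends to 0.\<close>

lemma mult_Gsq_tendsto_0: "((\<lambda>u. 2 * u * (1 - Gsq u)) \<longlongrightarrow> 0) (at 0)"
proof -
  have sq: "filterlim (\<lambda>u::complex. u\<^sup>2) (at 0) (at 0)"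
    unfolding filterlim_at by (auto intro!: tendsto_eq_intros simp: eventually_at_filter)
  have "((\<lambda>u::complex. inverse (Ln (1 + u\<^sup>2) / u\<^sup>2)) \<longlongrightarrow> inverse 1) (at 0)"
    by (intro tendsto_inverse filterlim_compose[OF Ln_add_one_over_tendsto_1 sq]) auto
  note 1 = this
  have "((\<lambda>u. 2 * u - 4 * (u ^ 3 * Ln u) + 8 * (u * (Ln u)\<^sup>2) * inverse (Ln (1 + u\<^sup>2) / u\<^sup>2))
       \<longlongrightarrow> 2 * 0 - 4 * 0 + 8 * 0 * inverse 1) (at 0)"
    by (intro tendsto_add tendsto_diff tendsto_mult tendsto_const tendsto_ident_at power_Ln_tendsto_0 1)
  moreover have "eventually (\<lambda>u. 2 * u - 4 * (u ^ 3 * Ln u) + 8 * (u * (Ln u)\<^sup>2) * inverse (Ln (1 + u\<^sup>2) / u\<^sup>2)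
      = 2 * u * (1 - Gsq u)) (at 0)"
  proof -
    have "eventually (\<lambda>u::complex. u \<in> ball 0 1) (at 0)" by (intro eventually_at_in_open') auto
    then show ?thesis
    proof eventually_elim
      case (elim u)
      then have "cmod u < 1" by simp
      then have "u \<noteq> \<i>" "u \<noteq> - \<i>" by auto
      then have "Lsq_inv u = inverse (Ln (1 + u\<^sup>2))"
        using Lsq_eq_Ln[of u] \<open>cmod u < 1\<close> by (simp add: Lsq_inv_def)
      then show ?case
        by (simp add: Gsq_def inverse_eq_divide algebra_simps power2_eq_square power3_eq_cube)
    qed
  qed
  ultimately show ?thesis by (simp add: tendsto_cong)
qed

lemma continuous_on_mult_Gsq: "continuous_on {w. 0 \<le> Re w} (\<lambda>u. 2 * u * (1 - Gsq u))"
  unfolding continuous_on_eq_continuous_within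
proof
  fix u :: complex assume u: "u \<in> {w. 0 \<le> Re w}"
  show "continuous (at u within {w. 0 \<le> Re w}) (\<lambda>u. 2 * u * (1 - Gsq u))"
  proof (cases "u = 0")
    case True
    then show ?thesis
      unfolding continuous_within using mult_Gsq_tendsto_0
      by (metis mult_zero_left mult_zero_right tendsto_within_subset subset_UNIV)
  next
    case False
    have "u \<notin> \<real>\<^sub>\<le>\<^sub>0" using u False by (auto simp: complex_nonpos_Reals_iff complex_eq_iff)
    then show ?thesis
      unfolding Gsq_def using u False
      by (intro continuous_intros continuous_within_Lsq_inv) auto
  qed
qed

lemma holomorphic_on_Gsq: "Gsq holomorphic_on {w. 0 < Re w}"
proof -
  have "(\<lambda>u. (1 - 2 * Ln u * inverse (Ln (u + \<i>) + Ln (u - \<i>))) * u\<^sup>2 * (2 * Ln u)) holomorphic_on {w. 0 < Re w}"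
  proof -
    have "Ln (u + \<i>) + Ln (u - \<i>) \<noteq> 0" if "0 < Re u" for u
    proof -
      have "u \<noteq> 0" "u \<noteq> \<i>" "u \<noteq> - \<i>" using that by auto
      then show ?thesis using Lsq_nonzero[of u] by (simp add: Lsq_def)
    qed
    then show ?thesis
      by (intro holomorphic_intros) (auto simp: complex_nonpos_Reals_iff)
  qed
  then show ?thesis
    by (rule holomorphic_transform) (auto simp: Gsq_def Lsq_inv_def Lsq_def)
qed

lemma holomorphic_on_G: "G holomorphic_on {z. 0 < Re z}"
proof -
  have "(\<lambda>z. (1 - Ln z / Ln (1 + z)) * z * Ln z) holomorphic_on {z. 0 < Re z}"
  proof -
    have "Ln (1 + z) \<noteq> 0" if "0 < Re z" for z
    proof -
      have "1 + z \<noteq> 0" "z \<noteq> 0" using that by (auto simp: complex_eq_iff)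
      then show ?thesis by (metis add_cancel_left_right exp_Ln exp_zero)
    qed
    then show ?thesis
      by (intro holomorphic_intros) (auto simp: complex_nonpos_Reals_iff)
  qed
  then show ?thesis by (simp add: G_def[abs_def])
qed

section \<open>Behaviour at infinity\<close>

text \<open>Factor u + c = u * (1 + c / u) for c = i and c = -i. As |c / u| < 1, the second factor
  has positive real part and argument strictly below pi/2 in modulus, so it can be added to an
  argument of u of modulus at most pi/2 without a jump, also on the boundary.\<close>

lemma Lsq_eq_at_infinity:
  assumes "0 \<le> Re u" "1 < cmod u"
  shows "Lsq u = 2 * Ln u + Ln (1 + 1 / u\<^sup>2)"
proof -
  have u0: "u \<noteq> 0" using assms by auto
  have Ln_u: "\<bar>Im (Ln u)\<bar> \<le> pi/2" using Re_Ln_pos_le u0 assms by blast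
  have pos: "0 < Re (1 + c / u)" if "cmod c = 1" for c
  proof -
    have "cmod (c / u) < 1" using that assms(2) u0 by (simp add: norm_divide divide_less_eq)
    then show ?thesis using abs_Re_le_cmod[of "c / u"] by simp
  qed
  have Ln_c: "\<bar>Im (Ln (1 + c / u))\<bar> < pi/2" if "cmod c = 1" for c
    using Re_Ln_pos_lt_imp pos[OF that] by blast
  have ne: "1 + c / u \<noteq> 0" if "cmod c = 1" for c
    using pos[OF that] by (metis less_irrefl zero_complex.simps(1))
  have 1: "Ln (u + c) = Ln u + Ln (1 + c / u)" if "cmod c = 1" for c
  proof -
    have "u + c = u * (1 + c / u)" using u0 by (simp add: field_simps)
    then show ?thesis
      using Ln_u Ln_c[OF that] ne[OF that] u0 by (simp only:) (intro Ln_times_simple; linarith)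
  qed
  have "(1 + \<i> / u) * (1 + (- \<i>) / u) = 1 + 1 / u\<^sup>2"
    using u0 by (simp add: field_simps power2_eq_square)
  then have "Ln (1 + 1 / u\<^sup>2) = Ln (1 + \<i> / u) + Ln (1 + (- \<i>) / u)"
    using Ln_c[of "\<i>"] Ln_c[of "- \<i>"] ne[of "\<i>"] ne[of "- \<i>"]
    by (subst Ln_times_simple[symmetric]) (auto simp: abs_less_iff)
  then show ?thesis using 1[of \<i>] 1[of "- \<i>"] by (simp add: Lsq_def)
qed

text \<open>With D = Ln (1 + 1 / u^2) and L = \<open>Lsq u\<close> = 2 * Ln u + D, the cancellation
  in \<open>Gsq\<close> becomes explicit: \<open>Gsq u\<close> = u^2 * D * (1 - D / L). Here u^2 * D
  tends to 1, D to 0, and L to infinity.\<close>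

lemma Gsq_tendsto_1: "(Gsq \<longlongrightarrow> 1) (inf at_infinity (principal {w. 0 \<le> Re w}))"
proof -
  define F where "F = inf at_infinity (principal {w::complex. 0 \<le> Re w})"
  have F: "F \<le> at_infinity" by (simp add: F_def)
  have ev: "eventually (\<lambda>u. 0 \<le> Re u \<and> 1 < cmod u) F"
    unfolding F_def eventually_inf_principal
    using eventually_at_infinity[of "\<lambda>u. 1 < cmod u"] by (auto intro!: exI[of _ 2] elim!: eventually_mono)
  have p: "filterlim (\<lambda>u. 1 / u\<^sup>2) (at 0) F"
    unfolding filterlim_at
  proof
    have "((\<lambda>u::complex. inverse (u\<^sup>2)) \<longlongrightarrow> 0) at_infinity"
      by (intro filterlim_compose[OF tendsto_inverse_0] filterlim_power_at_infinity filterlim_ident) auto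
    then show "((\<lambda>u. 1 / u\<^sup>2) \<longlongrightarrow> 0) F"
      using F by (simp add: tendsto_mono inverse_eq_divide)
    show "eventually (\<lambda>u. 1 / u\<^sup>2 \<in> UNIV \<and> 1 / u\<^sup>2 \<noteq> 0) F"
      using ev by eventually_elim auto
  qed
  have q: "((\<lambda>u. Ln (1 + 1 / u\<^sup>2) / (1 / u\<^sup>2)) \<longlongrightarrow> 1) F"
    by (rule filterlim_compose[OF Ln_add_one_over_tendsto_1 p])
  have D: "((\<lambda>u. Ln (1 + 1 / u\<^sup>2)) \<longlongrightarrow> 0) F"
  proof -
    have "((\<lambda>u. 1 / u\<^sup>2) \<longlongrightarrow> 0) F" using p unfolding filterlim_at by blast
    then have "((\<lambda>u. Ln (1 + 1 / u\<^sup>2)) \<longlongrightarrow> Ln (1 + 0)) F"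
      by (intro tendsto_intros) auto
    then show ?thesis by simp
  qed
  have "filterlim (\<lambda>u. 2 * ln (cmod u)) at_top F"
  proof -
    have "filterlim (\<lambda>x::real. 2 * ln x) at_top at_top" by real_asymp
    moreover have "filterlim cmod at_top F"
      using filterlim_norm_at_top F filterlim_mono by blast
    ultimately show ?thesis by (rule filterlim_compose)
  qed
  then have "filterlim (\<lambda>u. norm (2 * Ln u)) at_top F"
  proof (rule filterlim_at_top_mono)
    show "eventually (\<lambda>u. 2 * ln (cmod u) \<le> norm (2 * Ln u)) F"
      using ev
    proof eventually_elim
      case (elim u)
      then have "u \<noteq> 0" by auto
      then have "2 * ln (cmod u) = Re (2 * Ln u)" by simp
      also have "\<dots> \<le> norm (2 * Ln u)" by (rule complex_Re_le_cmod)
      finally show ?case .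
    qed
  qed
  then have "filterlim (\<lambda>u. 2 * Ln u) at_infinity F"
    by (rule filterlim_norm_at_top_imp_at_infinity)
  then have "filterlim (\<lambda>u. 2 * Ln u + Ln (1 + 1 / u\<^sup>2)) at_infinity F"
    using D tendsto_add_filterlim_at_infinity' by blast
  then have "((\<lambda>u. inverse (2 * Ln u + Ln (1 + 1 / u\<^sup>2))) \<longlongrightarrow> 0) F"
    using filterlim_compose[OF tendsto_inverse_0] by blast
  with q D have "((\<lambda>u. (Ln (1 + 1 / u\<^sup>2) / (1 / u\<^sup>2)) * (1 - Ln (1 + 1 / u\<^sup>2) *
      inverse (2 * Ln u + Ln (1 + 1 / u\<^sup>2)))) \<longlongrightarrow> 1 * (1 - 0 * 0)) F"
    by (intro tendsto_intros)
  moreover have "eventually (\<lambda>u. (Ln (1 + 1 / u\<^sup>2) / (1 / u\<^sup>2)) * (1 - Ln (1 + 1 / u\<^sup>2) *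
      inverse (2 * Ln u + Ln (1 + 1 / u\<^sup>2))) = Gsq u) F"
    using ev
  proof eventually_elim
    case (elim u)
    then have u: "u \<noteq> 0" "u \<noteq> \<i>" "u \<noteq> - \<i>" by auto
    define D where "D = Ln (1 + 1 / u\<^sup>2)"
    define L where "L = Lsq u"
    have L: "L = 2 * Ln u + D" unfolding L_def D_def using elim by (intro Lsq_eq_at_infinity) auto
    have L0: "L \<noteq> 0" unfolding L_def using u by (intro Lsq_nonzero)
    have "2 * Ln u = L - D" using L by simp
    then have "Gsq u = (1 - (L - D) * inverse L) * u\<^sup>2 * (L - D)"
      unfolding Gsq_def L_def using u by (simp add: Lsq_inv_def)
    also have "\<dots> = (D / (1 / u\<^sup>2)) * (1 - D * inverse L)"
      using L0 by (simp add: field_simps)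
    finally show ?case unfolding L D_def by simp
  qed
  ultimately show ?thesis unfolding F_def[symmetric] by (simp add: tendsto_cong)
qed

section \<open>Boundary values and the density \<open>rho\<close>\<close>

lemma Ln_ii_times:
  assumes "0 < v"
  shows "Ln (\<i> * of_real v) = of_real (ln v) + \<i> * of_real pi / 2"
    "Ln (- (\<i> * of_real v)) = of_real (ln v) - \<i> * of_real pi / 2"
  using Ln_times_of_real[of v "\<i>"] Ln_times_of_real[of v "- \<i>"] assms
  by (simp_all add: mult.commute Ln_of_real)

lemma Lsq_ii_times_less_1:
  assumes "0 < v" "v < 1"
  shows "Lsq (\<i> * of_real v) = of_real (ln (1 - v\<^sup>2))" "Lsq (- (\<i> * of_real v)) = of_real (ln (1 - v\<^sup>2))"
proof -
  have "v\<^sup>2 < 1" using assms by (simp add: power_less_one_iff)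
  have "Lsq (c * of_real v) = of_real (ln (1 - v\<^sup>2))" if "c\<^sup>2 = -1" "cmod c = 1" for c
  proof -
    have "Lsq (c * of_real v) = Ln (of_real (1 - v\<^sup>2))"
      using assms that by (subst Lsq_eq_Ln) (auto simp: norm_mult power_mult_distrib)
    then show ?thesis using \<open>v\<^sup>2 < 1\<close> by (subst (asm) Ln_of_real) auto
  qed
  from this[of \<i>] this[of "-\<i>"]
  show "Lsq (\<i> * of_real v) = of_real (ln (1 - v\<^sup>2))" "Lsq (- (\<i> * of_real v)) = of_real (ln (1 - v\<^sup>2))" by simp_all
qed

text \<open>Beyond the pole both factors lie on the same half of the imaginary axis, so their
  arguments add up to pi or -pi: the logarithm of 1 - v^2 < 0 from the two sides of its cut.\<close>

lemma Lsq_ii_times_greater_1: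
  assumes "1 < v"
  shows "Lsq (\<i> * of_real v) = of_real (ln (v\<^sup>2 - 1)) + \<i> * of_real pi"
    "Lsq (- (\<i> * of_real v)) = of_real (ln (v\<^sup>2 - 1)) - \<i> * of_real pi"
proof -
  have e: "\<i> * of_real v + \<i> = \<i> * of_real (v + 1)" "\<i> * of_real v - \<i> = \<i> * of_real (v - 1)"
    "- (\<i> * of_real v) + \<i> = - (\<i> * of_real (v - 1))" "- (\<i> * of_real v) - \<i> = - (\<i> * of_real (v + 1))"
    by (simp_all add: algebra_simps)
  have "v\<^sup>2 - 1 = (v + 1) * (v - 1)" by (simp add: algebra_simps power2_eq_square)
  then have "ln (v\<^sup>2 - 1) = ln (v + 1) + ln (v - 1)" using assms by (simp add: ln_mult)
  then show "Lsq (\<i> * of_real v) = of_real (ln (v\<^sup>2 - 1)) + \<i> * of_real pi"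
    "Lsq (- (\<i> * of_real v)) = of_real (ln (v\<^sup>2 - 1)) - \<i> * of_real pi"
    unfolding Lsq_def e using assms by (simp_all add: Ln_ii_times del: of_real_add of_real_diff) simp_all
qed

lemma Gsq_minus_ii_times:
  assumes "0 < v"
  shows "Gsq (- (\<i> * of_real v)) = cnj (Gsq (\<i> * of_real v))"
proof -
  have "Lsq (- (\<i> * of_real v)) = cnj (Lsq (\<i> * of_real v))" if "v \<noteq> 1"
    using that assms by (cases "v < 1") (auto simp: Lsq_ii_times_less_1 Lsq_ii_times_greater_1)
  then have "Lsq_inv (- (\<i> * of_real v)) = cnj (Lsq_inv (\<i> * of_real v))"
    using assms by (cases "v = 1") (auto simp: Lsq_inv_def complex_eq_iff)
  moreover have "Ln (- (\<i> * of_real v)) = cnj (Ln (\<i> * of_real v))"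
    using assms by (simp add: Ln_ii_times)
  ultimately show ?thesis by (simp add: Gsq_def power_mult_distrib)
qed

text \<open>This is where \<open>rho\<close> comes from: up to the factor pi it is the imaginary
  part of \<open>G\<close> on the upper side of the cut. The cases follow the branches of
  \<open>Lsq\<close> below, at and above the pole.\<close>

lemma Im_Gsq_ii_times:
  assumes "0 < v"
  shows "Im (Gsq (\<i> * of_real v)) = pi * rho (v\<^sup>2)"
proof -
  define t where "t = v\<^sup>2"
  define L where "L = ln t"
  have t: "0 < t" using assms by (simp add: t_def)
  have Ln2: "2 * Ln (\<i> * of_real v) = Complex L pi"
    using assms by (simp add: Ln_ii_times L_def t_def ln_realpow complex_eq_iff)
  have sq: "(\<i> * of_real v)\<^sup>2 = - of_real t"
    by (simp add: t_def power_mult_distrib)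
  have G: "Gsq (\<i> * of_real v) = (1 - Complex L pi * Lsq_inv (\<i> * of_real v)) * (- of_real t) * Complex L pi"
    unfolding Gsq_def Ln2 sq ..
  consider "v < 1" | "v = 1" | "v > 1" by linarith
  then show ?thesis
  proof cases
    case 1
    define M where "M = ln (1 - t)"
    have t1: "t < 1" using 1 assms by (simp add: t_def power_less_one_iff)
    then have M: "M < 0" using t by (simp add: M_def)
    have Li: "Lsq_inv (\<i> * of_real v) = of_real (1 / M)"
      using 1 assms Lsq_ii_times_less_1[OF assms 1]
      by (auto simp: Lsq_inv_def M_def t_def complex_eq_iff divide_inverse)
    have rho: "rho t = - (t * (M - 2 * L)) / M"
      using t t1 by (simp add: rho_def M_def L_def ln_div ln_realpow)
    show ?thesis
      unfolding G Li t_def[symmetric] rho using M by (simp add: field_simps power2_eq_square)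
  next
    \<comment> \<open>At the pole \<open>Lsq_inv\<close> is 0 and \<open>Ln\<close> contributes the
      imaginary part pi, which matches the value -1 given to \<open>rho\<close> at 1.\<close>
    case 2
    then show ?thesis
      unfolding G by (simp add: Lsq_inv_def t_def rho_def)
  next
    case 3
    define N where "N = ln (t - 1)"
    have t1: "1 < t" using 3 by (simp add: t_def)
    have Li: "Lsq_inv (\<i> * of_real v) = inverse (Complex N pi)"
    proof -
      have "\<i> * of_real v \<noteq> \<i>" "\<i> * of_real v \<noteq> - \<i>" using 3 by (auto simp: complex_eq_iff)
      moreover have "Lsq (\<i> * of_real v) = Complex N pi"
        using Lsq_ii_times_greater_1[OF 3] by (simp add: N_def t_def complex_eq_iff)
      ultimately show ?thesis by (simp add: Lsq_inv_def)
    qed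
    have pos: "N\<^sup>2 + pi\<^sup>2 > 0" by (simp add: add_nonneg_pos)
    have "Complex N pi \<noteq> 0" by (simp add: complex_eq_iff)
    then have "1 - Complex L pi * inverse (Complex N pi) = (Complex N pi - Complex L pi) * inverse (Complex N pi)"
      by (simp add: left_diff_distrib)
    also have "Complex N pi - Complex L pi = of_real (N - L)" by (simp add: complex_eq_iff)
    finally have "1 - Complex L pi * inverse (Complex N pi) = of_real (N - L) * inverse (Complex N pi)" .
    then have "Gsq (\<i> * of_real v) = of_real (- t * (N - L)) * (inverse (Complex N pi) * Complex L pi)"
      unfolding G Li by simp
    also have "Im \<dots> = - t * (N - L) * Im (inverse (Complex N pi) * Complex L pi)"
      by (simp only: Im_complex_of_real Re_complex_of_real times_complex.sel)
    also have "Im (inverse (Complex N pi) * Complex L pi) = pi * (N - L) / (N\<^sup>2 + pi\<^sup>2)"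
      by (simp add: diff_divide_distrib right_diff_distrib mult.commute)
    also have "- t * (N - L) * (pi * (N - L) / (N\<^sup>2 + pi\<^sup>2)) = pi * rho t"
      using t t1 by (simp add: rho_def N_def L_def ln_div power2_eq_square)
    finally show ?thesis by (simp add: t_def)
  qed
qed

section \<open>Integrability of the density\<close>

lemma borel_measurable_rho [measurable]: "rho \<in> borel_measurable borel"
  unfolding rho_def[abs_def] by measurable

text \<open>On (0,1) the quotient of t by -ln (1 - t) is at most 1, leaving a logarithmic
  singularity at 0. In the tail, ln (t / (t - 1)) is at most 1 / (t - 1), and its square gains the
  decay that makes the bound integrable.\<close>

lemma abs_rho_le:
  shows "0 < t \<Longrightarrow> t < 1 \<Longrightarrow> \<bar>rho t\<bar> \<le> 1 - 2 * ln t"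
    and "1 \<le> t \<Longrightarrow> t \<le> 2 \<Longrightarrow> \<bar>rho t\<bar> \<le> 4"
    and "2 < t \<Longrightarrow> \<bar>rho t\<bar> \<le> 2 / ((t - 1) * ((ln (t - 1))\<^sup>2 + pi\<^sup>2))"
proof -
  assume t: "0 < t" "t < 1"
  define M where "M = ln (1 - t)"
  have M: "M \<le> - t" unfolding M_def using t ln_le_minus_one[of "1 - t"] by simp
  have rho: "rho t = - t + (- 2 * ln t) * (t / - M)"
    using t M by (simp add: rho_def M_def[symmetric] ln_div ln_realpow field_simps)
  have "0 \<le> t / - M" "t / - M \<le> 1" using t M by (auto simp: field_simps)
  have "ln t < 0" using t by simp
  then have "0 \<le> (- 2 * ln t) * (t / - M)"
    using \<open>0 \<le> t / - M\<close> by (intro mult_nonneg_nonneg[of "- 2 * ln t"]) linarith+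
  then have "\<bar>rho t\<bar> \<le> t + (- 2 * ln t) * (t / - M)"
    using t unfolding rho abs_le_iff by linarith
  also have "\<dots> \<le> 1 + (- 2 * ln t) * 1"
    using t \<open>t / - M \<le> 1\<close> \<open>ln t < 0\<close> by (intro add_mono mult_left_mono) auto
  finally show "\<bar>rho t\<bar> \<le> 1 - 2 * ln t" by simp
next
  assume t: "1 \<le> t" "t \<le> 2"
  show "\<bar>rho t\<bar> \<le> 4"
  proof (cases "t = 1")
    case False
    define A B where "A = ln (t - 1)" and "B = ln t"
    have pos: "A\<^sup>2 + pi\<^sup>2 > 0" by (simp add: add_nonneg_pos)
    have B: "0 \<le> B" "B \<le> 1" unfolding B_def using t ln_le_minus_one[of t] by auto
    then have B2: "B\<^sup>2 \<le> 1" by (simp add: abs_square_le_1)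
    have "1 \<le> pi\<^sup>2" using pi_gt3 by (simp add: one_le_power)
    \<comment> \<open>Here \<open>A\<close> is unbounded near t = 1 but also occurs in the
      denominator, while \<open>B\<^sup>2\<close> is absorbed by \<open>pi\<^sup>2\<close>.\<close>
    have "(A - B)\<^sup>2 \<le> 2 * (A\<^sup>2 + B\<^sup>2)"
      using zero_le_power2[of "A + B"] unfolding power2_sum power2_diff by (simp add: algebra_simps)
    also have "\<dots> \<le> 2 * (A\<^sup>2 + pi\<^sup>2)" using B2 \<open>1 \<le> pi\<^sup>2\<close> by (intro mult_left_mono add_left_mono) auto
    finally have "(A - B)\<^sup>2 \<le> 2 * (A\<^sup>2 + pi\<^sup>2)" .
    then have "t * (A - B)\<^sup>2 \<le> 2 * (2 * (A\<^sup>2 + pi\<^sup>2))"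
      using t by (intro mult_mono) auto
    then have "t * (A - B)\<^sup>2 / (A\<^sup>2 + pi\<^sup>2) \<le> 4" using pos by (simp add: divide_le_eq)
    moreover have "\<bar>rho t\<bar> = t * (A - B)\<^sup>2 / (A\<^sup>2 + pi\<^sup>2)"
      using t False pos by (simp add: rho_def A_def B_def ln_div abs_mult)
    ultimately show ?thesis by simp
  qed (simp add: rho_def)
next
  assume t: "2 < t"
  define s where "s = t - 1"
  have s: "s > 1" "t = s + 1" using t by (auto simp: s_def)
  have pos: "(ln s)\<^sup>2 + pi\<^sup>2 > 0" by (simp add: add_nonneg_pos)
  define D where "D = ln (t / s)"
  have D: "0 \<le> D" "D \<le> 1 / s"
  proof -
    show "0 \<le> D" unfolding D_def using s by simp
    have "D \<le> t / s - 1" unfolding D_def using s by (intro ln_le_minus_one) auto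
    also have "\<dots> = 1 / s" using s by (simp add: field_simps)
    finally show "D \<le> 1 / s" .
  qed
  have "(ln (s / t))\<^sup>2 = D\<^sup>2" using s by (simp add: D_def ln_div power2_commute)
  then have "\<bar>rho t\<bar> = t * D\<^sup>2 / ((ln s)\<^sup>2 + pi\<^sup>2)"
    using t pos by (simp add: rho_def s_def[symmetric] abs_mult)
  \<comment> \<open>From s > 1 follows t = s + 1 \<le> 2 * s.\<close>
  also have "t * D\<^sup>2 \<le> (2 * s) * (1 / s)\<^sup>2"
    using s D by (intro mult_mono power_mono) auto
  also have "(2 * s) * (1 / s)\<^sup>2 = 2 / s" using s by (simp add: power2_eq_square)
  finally show "\<bar>rho t\<bar> \<le> 2 / ((t - 1) * ((ln (t - 1))\<^sup>2 + pi\<^sup>2))"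
    using pos by (simp add: s_def divide_right_mono)
qed

lemma set_integrable_minus_ln: "set_integrable lborel {0<..<1} (\<lambda>t::real. - ln t)"
proof -
  have "set_integrable lborel (einterval (ereal 0) (ereal 1)) (\<lambda>t::real. - ln t)"
  proof (rule interval_integral_FTC_nonneg[where F = "\<lambda>t. t - t * ln t" and A = 0 and B = 1])
    show "DERIV (\<lambda>t. t - t * ln t) x :> - ln x" if "ereal 0 < ereal x" for x
      using that by (auto intro!: derivative_eq_intros)
    show "isCont (\<lambda>t. - ln t) x" if "ereal 0 < ereal x" for x :: real
      using that by (intro continuous_intros) auto
    have "((\<lambda>t::real. t - t * ln t) \<longlongrightarrow> 0) (at_right 0)" by real_asymp
    then show "(((\<lambda>t. t - t * ln t) \<circ> real_of_ereal) \<longlongrightarrow> 0) (at_right (ereal 0))"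
      by (simp add: ereal_tendsto_simps1)
    have "((\<lambda>t::real. t - t * ln t) \<longlongrightarrow> 1) (at_left 1)" by real_asymp
    then show "(((\<lambda>t. t - t * ln t) \<circ> real_of_ereal) \<longlongrightarrow> 1) (at_left (ereal 1))"
      by (simp add: ereal_tendsto_simps1)
  qed (auto intro!: AE_I2)
  then show ?thesis by simp
qed

text \<open>Substituting ln (t - 1) turns the integrand into the derivative of an arctangent. The
  primitive vanishes at t = 2 and tends to 1 at infinity, whence \<open>A = 0\<close> and
  \<open>B = 1\<close>.\<close>

lemma set_integrable_inverse_ln_square:
  "set_integrable lborel {2<..} (\<lambda>t::real. 2 / ((t - 1) * ((ln (t - 1))\<^sup>2 + pi\<^sup>2)))"
proof -
  have "set_integrable lborel (einterval (ereal 2) \<infinity>) (\<lambda>t::real. 2 / ((t - 1) * ((ln (t - 1))\<^sup>2 + pi\<^sup>2)))"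
  proof (rule interval_integral_FTC_nonneg[where F = "\<lambda>t. 2 / pi * arctan (ln (t - 1) / pi)" and A = 0 and B = 1])
    fix x assume "ereal 2 < ereal x"
    then have x: "x > 2" by simp
    have pos: "(ln (x - 1))\<^sup>2 + pi\<^sup>2 > 0" by (simp add: add_nonneg_pos)
    have "DERIV (\<lambda>t. 2 / pi * arctan (ln (t - 1) / pi)) x :>
        2 / pi * (inverse (1 + (ln (x - 1) / pi)\<^sup>2) * ((1 / (x - 1)) / pi))"
      using x by (auto intro!: derivative_eq_intros simp: mult_ac)
    also have "2 / pi * (inverse (1 + (ln (x - 1) / pi)\<^sup>2) * ((1 / (x - 1)) / pi)) =
       2 / ((x - 1) * (pi\<^sup>2 * (1 + (ln (x - 1) / pi)\<^sup>2)))"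
      by (simp add: divide_inverse power2_eq_square mult_ac)
    also have "pi\<^sup>2 * (1 + (ln (x - 1) / pi)\<^sup>2) = (ln (x - 1))\<^sup>2 + pi\<^sup>2"
      by (simp add: power_divide distrib_left)
    finally show "DERIV (\<lambda>t. 2 / pi * arctan (ln (t - 1) / pi)) x :> 2 / ((x - 1) * ((ln (x - 1))\<^sup>2 + pi\<^sup>2))" .
    show "isCont (\<lambda>t. 2 / ((t - 1) * ((ln (t - 1))\<^sup>2 + pi\<^sup>2))) x"
      using x pos by (intro continuous_intros) auto
  next
    have "((\<lambda>t. 2 / pi * arctan (ln (t - 1) / pi)) \<longlongrightarrow> 0) (at_right 2)" by real_asymp
    then show "(((\<lambda>t. 2 / pi * arctan (ln (t - 1) / pi)) \<circ> real_of_ereal) \<longlongrightarrow> 0) (at_right (ereal 2))"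
      by (simp add: ereal_tendsto_simps1)
    have "filterlim (\<lambda>t. ln (t - 1) / pi) at_top at_top" by real_asymp
    then have "((\<lambda>t. 2 / pi * arctan (ln (t - 1) / pi)) \<longlongrightarrow> 2 / pi * (pi / 2)) at_top"
      by (intro tendsto_mult tendsto_const filterlim_compose[OF tendsto_arctan_at_top])
    then have "((\<lambda>t. 2 / pi * arctan (ln (t - 1) / pi)) \<longlongrightarrow> 1) at_top" by simp
    then show "(((\<lambda>t. 2 / pi * arctan (ln (t - 1) / pi)) \<circ> real_of_ereal) \<longlongrightarrow> 1) (at_left \<infinity>)"
      by (simp add: ereal_tendsto_simps1)
  qed (auto intro!: AE_I2)
  moreover have "einterval (ereal 2) \<infinity> = {2<..}" by (auto simp: einterval_def)
  ultimately show ?thesis by simp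
qed

lemma integrable_rho: "integrable lborel rho"
proof (rule Bochner_Integration.integrable_bound)
  let ?w = "\<lambda>t. (indicator {0<..<1} t *\<^sub>R 1 + 2 * (indicator {0<..<1} t *\<^sub>R - ln t)) + indicator {1..2} t *\<^sub>R 4
    + indicator {2<..} t *\<^sub>R (2 / ((t - 1) * ((ln (t - 1))\<^sup>2 + pi\<^sup>2)))"
  show "integrable lborel ?w"
    using set_integrable_minus_ln set_integrable_inverse_ln_square unfolding set_integrable_def
    by (intro Bochner_Integration.integrable_add integrable_mult_right) auto
  show "AE t in lborel. norm (rho t) \<le> norm (?w t)"
  proof (intro AE_I2)
    fix t :: real
    consider "t \<le> 0" | "0 < t" "t < 1" | "1 \<le> t" "t \<le> 2" | "2 < t" by linarith
    then show "norm (rho t) \<le> norm (?w t)"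
      by cases (use abs_rho_le[of t] in \<open>auto simp: rho_def[of t] indicator_def\<close>)
  qed
qed simp

section \<open>Sign of the density and of its Laplace transform\<close>

text \<open>The value 0 of \<open>rho\<close> on the nonpositive reals allows integration over the
  whole line; many later case splits on \<open>t \<le> 0\<close> rest on the same
  convention.\<close>

lemma phi_eq: "phi s = (LINT t|lborel. exp (- (s * t)) * rho t)"
  unfolding phi_def set_lebesgue_integral_def
  by (intro Bochner_Integration.integral_cong) (auto simp: indicator_def rho_def)

lemma rho_sign:
  obtains t0 where "\<And>t. t < t0 \<Longrightarrow> 0 \<le> rho t" "\<And>t. t0 < t \<Longrightarrow> rho t \<le> 0"
proof
  \<comment> \<open>The positive root of t^2 = 1 - t, where the logarithm of (1 - t) / t^2 changes
    sign. Beyond 1 the sign is evident from the square.\<close>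
  define t0 where "t0 = (sqrt 5 - 1) / 2"
  have s5: "2 < sqrt (5::real)" "sqrt (5::real) < 3" by (auto simp: real_less_rsqrt real_less_lsqrt)
  then have t0: "0 < t0" "t0 < 1" by (auto simp: t0_def)
  have t0_eq: "t0\<^sup>2 = 1 - t0" by (simp add: t0_def power2_eq_square field_simps)
  have M: "ln (1 - t) < 0" if "0 < t" "t < 1" for t :: real using that by simp
  show "0 \<le> rho t" if "t < t0" for t
  proof (cases "t \<le> 0")
    case False
    then have t: "0 < t" "t < 1" using that t0 by auto
    have "t\<^sup>2 \<le> t0\<^sup>2" using t that by (intro power_mono) auto
    then have "t\<^sup>2 \<le> 1 - t" using t0_eq that by linarith
    then have "1 \<le> (1 - t) / t\<^sup>2" using t by (simp add: le_divide_eq)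
    then have "0 \<le> ln ((1 - t) / t\<^sup>2)" by (rule ln_ge_zero)
    then have "t * ln ((1 - t) / t\<^sup>2) / ln (1 - t) \<le> 0"
      using t M[OF t] by (intro divide_nonneg_neg mult_nonneg_nonneg) auto
    then show ?thesis using t by (simp add: rho_def)
  qed (simp add: rho_def)
  show "rho t \<le> 0" if "t0 < t" for t
  proof -
    consider "t < 1" | "t = 1" | "t > 1" by linarith
    then show ?thesis
    proof cases
      case 1
      have t: "0 < t" "t < 1" using that t0 1 by auto
      have "t0\<^sup>2 \<le> t\<^sup>2" using t0 that by (intro power_mono) auto
      then have "1 - t \<le> t\<^sup>2" using t0_eq that by linarith
      then have "(1 - t) / t\<^sup>2 \<le> 1" using t by (simp add: divide_le_eq)
      then have "ln ((1 - t) / t\<^sup>2) \<le> 0" using t by (intro ln_le_zero_iff[THEN iffD2]) auto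
      then have "0 \<le> t * ln ((1 - t) / t\<^sup>2) / ln (1 - t)"
        using t M[OF t] by (intro divide_nonpos_neg mult_nonneg_nonpos) auto
      then show ?thesis using t by (simp add: rho_def)
    next
      case 3
      then show ?thesis by (auto simp: rho_def intro!: divide_nonneg_nonneg)
    qed (simp add: rho_def)
  qed
qed

lemma integrable_exp_rho:
  assumes "0 \<le> s" shows "integrable lborel (\<lambda>t. exp (- (s * t)) * rho t)"
proof (rule Bochner_Integration.integrable_bound[OF integrable_rho])
  show "AE t in lborel. norm (exp (- (s * t)) * rho t) \<le> norm (rho t)"
  proof (intro AE_I2)
    fix t show "norm (exp (- (s * t)) * rho t) \<le> norm (rho t)"
    proof (cases "t \<le> 0")
      case False
      then show ?thesis
        using assms mult_left_le_one_le[of "\<bar>rho t\<bar>" "exp (- (s * t))"] by (simp add: abs_mult)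
    qed (simp add: rho_def)
  qed
qed measurable

text \<open>The total mass of \<open>rho\<close> enters as a hypothesis, because its sign is
  obtained only later, from the Stieltjes representation.\<close>

lemma phi_nonneg:
  assumes "0 \<le> s" "0 \<le> integral\<^sup>L lborel rho"
  shows "0 \<le> phi s"
proof -
  obtain t0 where t0: "\<And>t. t < t0 \<Longrightarrow> 0 \<le> rho t" "\<And>t. t0 < t \<Longrightarrow> rho t \<le> 0"
    by (rule rho_sign) blast
  have "0 \<le> exp (- (s * t0)) * integral\<^sup>L lborel rho" using assms by simp
  also have "\<dots> = (LINT t|lborel. exp (- (s * t0)) * rho t)" by simp
  also have "\<dots> \<le> (LINT t|lborel. exp (- (s * t)) * rho t)"
  proof (rule integral_mono)
    fix t
    \<comment> \<open>The exponential decreases in t: to the left of \<open>t0\<close> the larger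
      weight meets \<open>rho \<ge> 0\<close>, to the right the smaller one meets
      \<open>rho \<le> 0\<close>.\<close>
    show "exp (- (s * t0)) * rho t \<le> exp (- (s * t)) * rho t"
    proof (cases t t0 rule: linorder_cases)
      case less
      then show ?thesis using t0(1) assms(1) by (intro mult_right_mono) (auto intro: mult_left_mono)
    next
      case greater
      then show ?thesis using t0(2) assms(1) by (intro mult_right_mono_neg) (auto intro: mult_left_mono)
    qed simp
  qed (use integrable_rho integrable_exp_rho assms in auto)
  finally show ?thesis by (simp add: phi_eq)
qed

section \<open>Stieltjes and Laplace representations\<close>

text \<open>Translates the gauge integral along the imaginary axis into a Lebesgue integral in t =
  v^2. Real and imaginary parts are substituted separately and recombined.\<close>

lemma has_integral_substitution_power2:
  fixes g :: "real \<Rightarrow> complex"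
  assumes g: "integrable lborel g" and "0 \<le> R"
  shows "((\<lambda>v. of_real (2 * v) * g (v\<^sup>2)) has_integral (LINT t:{0..R\<^sup>2}|lborel. g t)) {0..R}"
proof -
  have real: "((\<lambda>v. f (v\<^sup>2) * (2 * v)) has_integral (LINT t:{0..R\<^sup>2}|lborel. f t)) {0..R}"
    if f: "integrable lborel f" for f :: "real \<Rightarrow> real"
  proof -
    have si: "set_integrable lborel {0\<^sup>2..R\<^sup>2} f"
      unfolding set_integrable_def using f by (intro integrable_mult_indicator) auto
    have deriv: "((\<lambda>v. v\<^sup>2) has_real_derivative 2 * v) (at v)" for v :: real
      by (auto intro!: derivative_eq_intros)
    note sub = integral_substitution[where g = "\<lambda>v. v\<^sup>2" and g' = "\<lambda>v. 2 * v" and a = 0 and b = R, OF si deriv]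
    have 1: "set_integrable lborel {0..R} (\<lambda>v. f (v\<^sup>2) * (2 * v))"
      by (rule sub(1)) (use assms(2) in \<open>auto intro!: continuous_intros\<close>)
    have 2: "(LBINT t. f t * indicator {0\<^sup>2..R\<^sup>2} t) = (LBINT v. f (v\<^sup>2) * (2 * v) * indicator {0..R} v)"
      by (rule sub(2)) (use assms(2) in \<open>auto intro!: continuous_intros\<close>)
    have "(LINT t:{0..R\<^sup>2}|lborel. f t) = (LINT v:{0..R}|lborel. f (v\<^sup>2) * (2 * v))"
      using 2 by (simp add: set_lebesgue_integral_def mult.commute)
    then show ?thesis
      using set_borel_integral_eq_integral[OF 1] by (simp add: has_integral_integral)
  qed
  have Re: "integrable lborel (\<lambda>t. Re (g t))" and Im: "integrable lborel (\<lambda>t. Im (g t))"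
    using g by auto
  have si: "integrable lborel (\<lambda>t. indicator {0..R\<^sup>2} t *\<^sub>R g t)"
    using g by (intro integrable_mult_indicator) auto
  have "((\<lambda>v. complex_of_real (Re (g (v\<^sup>2)) * (2 * v)) + \<i> * complex_of_real (Im (g (v\<^sup>2)) * (2 * v))) has_integral
     complex_of_real (LINT t:{0..R\<^sup>2}|lborel. Re (g t)) + \<i> * complex_of_real (LINT t:{0..R\<^sup>2}|lborel. Im (g t))) {0..R}"
    using has_integral_linear[OF real[OF Re] bounded_linear_of_real]
      has_integral_linear[OF real[OF Im] bounded_linear_of_real]
    by (intro has_integral_add has_integral_mult_right) (simp_all add: o_def)
  also have "(\<lambda>v. complex_of_real (Re (g (v\<^sup>2)) * (2 * v)) + \<i> * complex_of_real (Im (g (v\<^sup>2)) * (2 * v))) =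
      (\<lambda>v. of_real (2 * v) * g (v\<^sup>2))"
    by (auto simp: complex_eq_iff)
  also have "complex_of_real (LINT t:{0..R\<^sup>2}|lborel. Re (g t)) + \<i> * complex_of_real (LINT t:{0..R\<^sup>2}|lborel. Im (g t))
     = (LINT t:{0..R\<^sup>2}|lborel. g t)"
    using integral_Re[OF si] integral_Im[OF si] by (simp add: complex_eq_iff set_lebesgue_integral_def)
  finally show ?thesis .
qed

lemma norm_of_real_add_ge:
  assumes "0 < Re z" "0 < t"
  shows "Re z \<le> cmod (z + of_real t)"
  using complex_Re_le_cmod[of "z + of_real t"] assms by simp

lemma integrable_rho_divide:
  assumes "0 < Re z"
  shows "integrable lborel (\<lambda>t. of_real (rho t) / (z + of_real t))"
proof (rule Bochner_Integration.integrable_bound)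
  show "integrable lborel (\<lambda>t. rho t / Re z)" using integrable_rho by simp
  show "AE t in lborel. cmod (of_real (rho t) / (z + of_real t)) \<le> norm (rho t / Re z)"
  proof (intro AE_I2)
    fix t
    show "cmod (of_real (rho t) / (z + of_real t)) \<le> norm (rho t / Re z)"
    proof (cases "t \<le> 0")
      case False
      then show ?thesis
        using norm_of_real_add_ge[OF assms, of t] assms by (auto simp: norm_divide intro!: divide_left_mono mult_pos_pos)
    qed (simp add: rho_def)
  qed
qed measurable

lemma integral_symmetric_interval:
  fixes k :: "real \<Rightarrow> complex"
  assumes "continuous_on {-R..R} k" "0 \<le> R"
  shows "integral {-R..R} k = integral {0..R} (\<lambda>v. k v + k (- v))"
proof -
  have int: "k integrable_on {-R..R}" using assms(1) by (rule integrable_continuous_real)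
  have pos: "k integrable_on {0..R}"
    using assms(2) by (intro integrable_continuous_real continuous_on_subset[OF assms(1)]) auto
  have "k integrable_on {-R..0}"
    using assms(2) by (intro integrable_continuous_real continuous_on_subset[OF assms(1)]) auto
  then have neg: "(\<lambda>v. k (- v)) integrable_on {0..R}"
    using Henstock_Kurzweil_Integration.integrable_reflect_real[where f = k and a = "- R" and b = 0] by simp
  have "integral {-R..R} k = integral {-R..0} k + integral {0..R} k"
    using assms(2) int by (intro Henstock_Kurzweil_Integration.integral_combine[symmetric]) auto
  also have "integral {-R..0} k = integral {0..R} (\<lambda>v. k (- v))"
    using Henstock_Kurzweil_Integration.integral_reflect_real[where f = k and a = "- R" and b = 0] by simp
  finally show ?thesis
    using pos neg by (simp add: Henstock_Kurzweil_Integration.integral_add add.commute)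
qed

theorem Stieltjes_representation:
  assumes z: "0 < Re z"
  shows "1 - G z = (LINT t|lborel. of_real (rho t) / (z + of_real t))"
proof -
  define u0 where "u0 = csqrt z"
  have u0_sq: "u0\<^sup>2 = z" by (simp add: u0_def)
  have u0: "0 < Re u0"
  proof -
    \<comment> \<open>A square root on the imaginary axis would have a square with nonpositive real
      part.\<close>
    have "Re u0 \<noteq> 0"
    proof
      assume "Re u0 = 0"
      then have "Re (u0\<^sup>2) \<le> 0" by (simp add: power2_eq_square)
      then show False using z u0_sq by simp
    qed
    then show ?thesis using csqrt_principal[of z] by (auto simp: u0_def)
  qed
  \<comment> \<open>The denominator has no zero in the closed half plane. It makes
    \<open>f u0\<close> equal to 1 - G z and, multiplied by Cauchy's u0 - i v, yields the Stieltjes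
    denominator z + v^2.\<close>
  define f where "f u = 2 * u * (1 - Gsq u) / (u + u0)" for u
  have ne: "u + u0 \<noteq> 0" if "0 \<le> Re u" for u
    using that u0 by (auto simp: complex_eq_iff)
  have cont: "continuous_on {w. 0 \<le> Re w} f"
    unfolding f_def[abs_def] using ne by (intro continuous_intros continuous_on_mult_Gsq) auto
  have holo: "f holomorphic_on {w. 0 < Re w}"
    unfolding f_def[abs_def] using ne by (intro holomorphic_intros holomorphic_on_Gsq) (auto simp: less_imp_le)
  have lim: "(f \<longlongrightarrow> 0) (inf at_infinity (principal {w. 0 \<le> Re w}))" (is "(f \<longlongrightarrow> 0) ?F")
  proof -
    have "filterlim (\<lambda>u. u + u0) at_infinity at_infinity"
      by (rule tendsto_add_filterlim_at_infinity'[OF filterlim_ident tendsto_const])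
    then have "((\<lambda>u. inverse (u + u0)) \<longlongrightarrow> 0) at_infinity"
      by (rule filterlim_compose[OF tendsto_inverse_0])
    then have "((\<lambda>u. inverse (u + u0)) \<longlongrightarrow> 0) ?F" by (rule tendsto_mono[rotated]) simp
    \<comment> \<open>The quotient u / (u + u0) is written as 1 - u0 / (u + u0), so the decay of
      \<open>f\<close> comes from 1 - \<open>Gsq\<close> alone.\<close>
    then have "((\<lambda>u. 2 * (1 - Gsq u) * (1 - u0 * inverse (u + u0))) \<longlongrightarrow> 2 * (1 - 1) * (1 - u0 * 0)) ?F"
      by (intro tendsto_mult tendsto_diff tendsto_const Gsq_tendsto_1)
    moreover have "eventually (\<lambda>u. 2 * (1 - Gsq u) * (1 - u0 * inverse (u + u0)) = f u) ?F"
      unfolding eventually_inf_principal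
    proof (intro always_eventually allI impI)
      fix u assume "u \<in> {w. 0 \<le> Re w}"
      then have "1 - u0 * inverse (u + u0) = u / (u + u0)" using ne[of u] by (simp add: field_simps)
      then show "2 * (1 - Gsq u) * (1 - u0 * inverse (u + u0)) = f u"
        by (simp add: f_def)
    qed
    ultimately show ?thesis by (simp add: tendsto_cong)
  qed
  have fu0: "f u0 = 1 - G z"
    using u0 Gsq_eq_G[OF u0] ne[of u0] by (auto simp: f_def u0_sq)
  define k where "k v = f (\<i> * of_real v) / (u0 - \<i> * of_real v)" for v
  define g where "g t = of_real (rho t) / (z + of_real t)" for t
  have g: "integrable lborel g"
    unfolding g_def using z by (rule integrable_rho_divide)
  have k: "k v = 2 * \<i> * of_real v * (1 - Gsq (\<i> * of_real v)) / (z + of_real (v\<^sup>2))" for v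
  proof -
    have "(\<i> * of_real v + u0) * (u0 - \<i> * of_real v) = z + of_real (v\<^sup>2)"
      by (simp add: algebra_simps power2_eq_square flip: u0_sq)
    then show ?thesis by (simp add: k_def f_def mult.assoc)
  qed
  \<comment> \<open>The constant 1 cancels because u is odd along the axis; of the conjugate
    boundary values only the imaginary part, and hence \<open>rho\<close>, survives.\<close>
  have k_sum: "k v + k (- v) = 2 * pi * (of_real (2 * v) * g (v\<^sup>2))" if "0 \<le> v" for v
  proof (cases "v = 0")
    case False
    then have v: "0 < v" using that by simp
    have "k v + k (- v) = 2 * \<i> * of_real v * (cnj (Gsq (\<i> * of_real v)) - Gsq (\<i> * of_real v)) / (z + of_real (v\<^sup>2))"
      unfolding k using Gsq_minus_ii_times[OF v]
      by (simp add: add_divide_distrib[symmetric] algebra_simps)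
    also have "cnj (Gsq (\<i> * of_real v)) - Gsq (\<i> * of_real v) = - (2 * \<i> * of_real (pi * rho (v\<^sup>2)))"
      using Im_Gsq_ii_times[OF v] by (simp add: complex_eq_iff)
    finally show ?thesis by (simp add: g_def algebra_simps)
  qed (simp add: k)
  have int_eq: "integral {-R..R} k = 2 * pi * (LINT t:{0..R\<^sup>2}|lborel. g t)" if "0 \<le> R" for R
  proof -
    have "continuous_on {-R..R} k"
      unfolding k_def[abs_def] using u0
      by (intro continuous_intros continuous_on_compose2[OF cont]) (auto simp: complex_eq_iff)
    then have "integral {-R..R} k = integral {0..R} (\<lambda>v. k v + k (- v))"
      using that by (rule integral_symmetric_interval)
    also have "\<dots> = integral {0..R} (\<lambda>v. 2 * pi * (of_real (2 * v) * g (v\<^sup>2)))"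
      by (intro integral_cong k_sum) auto
    also have "\<dots> = 2 * pi * integral {0..R} (\<lambda>v. of_real (2 * v) * g (v\<^sup>2))"
      by (rule integral_mult_right)
    also have "integral {0..R} (\<lambda>v. of_real (2 * v) * g (v\<^sup>2)) = (LINT t:{0..R\<^sup>2}|lborel. g t)"
      using has_integral_substitution_power2[OF g that] by (rule integral_unique)
    finally show ?thesis by simp
  qed
  have lim1: "((\<lambda>R. integral {-R..R} k) \<longlongrightarrow> 2 * pi * (1 - G z)) at_top"
    using Cauchy_integral_right_half_plane[OF cont holo lim u0] unfolding fu0 k_def .
  have lim2: "((\<lambda>R. integral {-R..R} k) \<longlongrightarrow> 2 * pi * (LINT t|lborel. g t)) at_top"
  proof -
    have "((\<lambda>R. LINT t|lborel. indicator {0..R\<^sup>2} t *\<^sub>R g t) \<longlongrightarrow> (LINT t|lborel. g t)) at_top"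
    proof (rule integral_dominated_convergence_at_top[where w = "\<lambda>t. norm (g t)"])
      show "AE t in lborel. ((\<lambda>R. indicator {0..R\<^sup>2} t *\<^sub>R g t) \<longlongrightarrow> g t) at_top"
      proof (intro AE_I2)
        fix t
        have "eventually (\<lambda>R. indicator {0..R\<^sup>2} t *\<^sub>R g t = g t) at_top"
        proof (cases "t < 0")
          case False
          \<comment> \<open>The bound 1 ensures R^2 \<ge> R \<ge> t.\<close>
          have "eventually (\<lambda>R. R \<ge> max 1 t) at_top" by (rule eventually_ge_at_top)
          then show ?thesis
          proof eventually_elim
            case (elim R)
            then have "R * 1 \<le> R * R" by (intro mult_left_mono) auto
            then have "t \<le> R\<^sup>2" using elim unfolding power2_eq_square by linarith
            then show ?case using False by simp
          qed
        qed (simp add: g_def rho_def)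
        then show "((\<lambda>R. indicator {0..R\<^sup>2} t *\<^sub>R g t) \<longlongrightarrow> g t) at_top"
          by (rule tendsto_eventually)
      qed
      show "eventually (\<lambda>R. AE t in lborel. norm (indicator {0..R\<^sup>2} t *\<^sub>R g t) \<le> norm (g t)) at_top"
        by (auto simp: indicator_def)
    qed (use g in auto)
    then have "((\<lambda>R. 2 * pi * (LINT t:{0..R\<^sup>2}|lborel. g t)) \<longlongrightarrow> 2 * pi * (LINT t|lborel. g t)) at_top"
      unfolding set_lebesgue_integral_def by (rule tendsto_mult_left)
    then show ?thesis
    proof (rule Lim_transform_eventually)
      show "eventually (\<lambda>R. 2 * pi * (LINT t:{0..R\<^sup>2}|lborel. g t) = integral {-R..R} k) at_top"
        using eventually_ge_at_top[of 0] by eventually_elim (simp add: int_eq)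
    qed
  qed
  have "2 * pi * (1 - G z) = 2 * pi * (LINT t|lborel. g t)"
    using tendsto_unique[OF _ lim1 lim2] by simp
  then show ?thesis by (simp add: g_def)
qed

section \<open>Positivity of the total mass\<close>

lemma G_of_real:
  assumes "0 < x"
  shows "G (of_real x) = of_real ((1 - ln x / ln (1 + x)) * x * ln x)"
proof -
  have "Ln (1 + of_real x) = of_real (ln (1 + x))"
    using Ln_of_real[of "1 + x"] assms by simp
  then show ?thesis using assms by (simp add: G_def Ln_of_real)
qed

text \<open>For real x, x * (1 - G x) is the integral of \<open>x * rho t / (x + t)\<close>, which
  tends to the total mass by dominated convergence. Each such value is nonnegative: for x \<ge> 1, G
  x is the product of x * ln (1 + 1 / x) and ln x / ln (1 + x), both between 0 and 1.\<close>

lemma integral_rho_nonneg: "0 \<le> integral\<^sup>L lborel rho"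
proof (rule LIMSEQ_le_const)
  \<comment> \<open>The successor keeps x \<ge> 1, so that ln x is nonnegative.\<close>
  let ?x = "\<lambda>n. real (Suc n)"
  show "(\<lambda>n. LINT t|lborel. ?x n * rho t / (?x n + t)) \<longlonglongrightarrow> integral\<^sup>L lborel rho"
  proof (rule integral_dominated_convergence[where w = "\<lambda>t. norm (rho t)"])
    show "AE t in lborel. (\<lambda>n. ?x n * rho t / (?x n + t)) \<longlonglongrightarrow> rho t"
    proof (intro AE_I2)
      fix t
      show "(\<lambda>n. ?x n * rho t / (?x n + t)) \<longlonglongrightarrow> rho t" by real_asymp
    qed
    show "AE t in lborel. norm (?x n * rho t / (?x n + t)) \<le> norm (rho t)" for n
    proof (intro AE_I2)
      fix t
      show "norm (?x n * rho t / (?x n + t)) \<le> norm (rho t)"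
      proof (cases "t \<le> 0")
        case False
        then have "0 \<le> ?x n / (?x n + t)" "?x n / (?x n + t) \<le> 1" by auto
        then show ?thesis
          using mult_left_le_one_le[of "\<bar>rho t\<bar>" "?x n / (?x n + t)"] False by (simp add: abs_mult)
      qed (simp add: rho_def)
    qed
  qed (use integrable_rho in auto)
  have "0 \<le> (LINT t|lborel. ?x n * rho t / (?x n + t))" for n
  proof -
    define x where "x = ?x n"
    have x: "1 \<le> x" by (simp add: x_def)
    have "complex_of_real (LINT t|lborel. rho t / (x + t)) = 1 - G (of_real x)"
      using Stieltjes_representation[of "of_real x"] x
      by (simp flip: integral_complex_of_real)
    also have "\<dots> = of_real (1 - (1 - ln x / ln (1 + x)) * x * ln x)"
      using x by (simp add: G_of_real)
    finally have eq: "(LINT t|lborel. rho t / (x + t)) = 1 - (1 - ln x / ln (1 + x)) * x * ln x"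
      by (simp only: of_real_eq_iff)
    have ln: "0 < ln (1 + x)" "0 \<le> ln x" "ln x \<le> ln (1 + x)" using x by auto
    have "ln (1 + x) - ln x = ln (1 + 1 / x)"
      using x ln_div[of "1 + x" x] by (simp add: add_divide_distrib add.commute)
    also have "\<dots> \<le> 1 / x" using x by (intro ln_add_one_self_le_self) auto
    finally have "x * (ln (1 + x) - ln x) \<le> 1" using x by (simp add: field_simps)
    moreover have "(1 - ln x / ln (1 + x)) * x * ln x = (x * (ln (1 + x) - ln x)) * (ln x / ln (1 + x))"
      using ln by (simp add: field_simps)
    moreover have "(x * (ln (1 + x) - ln x)) * (ln x / ln (1 + x)) \<le> 1 * 1"
      using ln x \<open>x * (ln (1 + x) - ln x) \<le> 1\<close> by (intro mult_mono) auto
    ultimately have "0 \<le> (LINT t|lborel. rho t / (x + t))" unfolding eq by simp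
    then have "0 \<le> x * (LINT t|lborel. rho t / (x + t))" using x by simp
    also have "\<dots> = (LINT t|lborel. x * (rho t / (x + t)))"
      by (rule integral_mult_right_zero[symmetric])
    finally show ?thesis by (simp add: x_def)
  qed
  then show "\<exists>N. \<forall>n\<ge>N. 0 \<le> (LINT t|lborel. ?x n * rho t / (?x n + t))" by blast
qed

text \<open>Integrability comes from the modulus, a real exponential with an explicit primitive;
  after that the complex primitive gives the value.\<close>

lemma exp_half_line_integral:
  assumes "0 < Re w"
  shows "integrable lborel (\<lambda>s. indicator {0<..} s *\<^sub>R exp (- (w * of_real s)))"
    "(LINT s|lborel. indicator {0<..} s *\<^sub>R exp (- (w * of_real s))) = 1 / w"
proof -
  define a where "a = Re w"
  have a: "0 < a" using assms by (simp add: a_def)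
  have ei: "einterval (ereal 0) \<infinity> = {0<..}" by (auto simp: einterval_def)
  have "set_integrable lborel (einterval (ereal 0) \<infinity>) (\<lambda>s. exp (- (a * s)))"
  proof (rule interval_integral_FTC_nonneg[where F = "\<lambda>s. - exp (- (a * s)) / a" and A = "- 1 / a" and B = 0])
    show "DERIV (\<lambda>s. - exp (- (a * s)) / a) x :> exp (- (a * x))" for x
      using a by (auto intro!: derivative_eq_intros)
    have "((\<lambda>s. - exp (- (a * s)) / a) \<longlongrightarrow> - exp (- (a * 0)) / a) (at_right 0)"
      by (intro tendsto_intros) (use a in auto)
    then show "(((\<lambda>s. - exp (- (a * s)) / a) \<circ> real_of_ereal) \<longlongrightarrow> - 1 / a) (at_right (ereal 0))"
      by (simp add: ereal_tendsto_simps1)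
    have "((\<lambda>s. - exp (- (a * s)) / a) \<longlongrightarrow> 0) at_top" using a by real_asymp
    then show "(((\<lambda>s. - exp (- (a * s)) / a) \<circ> real_of_ereal) \<longlongrightarrow> 0) (at_left \<infinity>)"
      by (simp add: ereal_tendsto_simps1)
  qed (auto intro!: AE_I2 continuous_intros)
  then have real: "integrable lborel (\<lambda>s. indicator {0<..} s *\<^sub>R exp (- (a * s)))"
    by (simp add: ei set_integrable_def)
  show int: "integrable lborel (\<lambda>s. indicator {0<..} s *\<^sub>R exp (- (w * of_real s)))"
    by (rule Bochner_Integration.integrable_bound[OF real]) (auto simp: a_def indicator_def)
  have "(LBINT s=ereal 0..\<infinity>. exp (- (w * of_real s))) = 0 - (- 1 / w)"
  proof (rule interval_integral_FTC_integrable[where F = "\<lambda>s. - exp (- (w * of_real s)) / w"])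
    have "((\<lambda>s. - exp (- (w * s)) / w) has_field_derivative exp (- (w * x))) (at x)" for x
      using assms by (auto intro!: derivative_eq_intros)
    then show "((\<lambda>s. - exp (- (w * of_real s)) / w) has_vector_derivative exp (- (w * of_real x))) (at x)" for x
      by (rule has_vector_derivative_real_field)
    show "set_integrable lborel (einterval (ereal 0) \<infinity>) (\<lambda>s. exp (- (w * of_real s)))"
      using int by (simp add: ei set_integrable_def)
    have "((\<lambda>s. - exp (- (w * of_real s)) / w) \<longlongrightarrow> - exp (- (w * of_real 0)) / w) (at_right (0::real))"
      by (intro tendsto_intros) (use assms in auto)
    then show "(((\<lambda>s. - exp (- (w * of_real s)) / w) \<circ> real_of_ereal) \<longlongrightarrow> - 1 / w) (at_right (ereal 0))"
      by (simp add: ereal_tendsto_simps1)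
    have "((\<lambda>s. - exp (- (w * of_real s)) / w) \<longlongrightarrow> 0) (at_top :: real filter)"
    proof (rule Lim_null_comparison)
      show "eventually (\<lambda>s. norm (- exp (- (w * of_real s)) / w) \<le> exp (- (a * s)) / cmod w) at_top"
        by (simp add: norm_divide a_def)
      have "((\<lambda>s. exp (- (a * s))) \<longlongrightarrow> 0) at_top" using a by real_asymp
      then show "((\<lambda>s. exp (- (a * s)) / cmod w) \<longlongrightarrow> 0) at_top"
        using tendsto_divide_zero by blast
    qed
    then show "(((\<lambda>s. - exp (- (w * of_real s)) / w) \<circ> real_of_ereal) \<longlongrightarrow> 0) (at_left \<infinity>)"
      by (simp add: ereal_tendsto_simps1)
  qed (auto intro!: continuous_intros)
  then show "(LINT s|lborel. indicator {0<..} s *\<^sub>R exp (- (w * of_real s))) = 1 / w"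
    by (simp add: interval_lebesgue_integral_def ei set_lebesgue_integral_def)
qed

text \<open>Fubini for exp (-(z + t) * s) * rho t. Integrating over s first gives the Stieltjes
  kernel, integrating over t first gives \<open>phi\<close>.\<close>

lemma Laplace_phi:
  assumes z: "0 < Re z"
  shows "integrable lborel (\<lambda>s. indicator {0<..} s *\<^sub>R (exp (- (z * of_real s)) * of_real (phi s)))"
    "1 - G z = (LINT s|lborel. indicator {0<..} s *\<^sub>R (exp (- (z * of_real s)) * of_real (phi s)))"
proof -
  define f where "f t s = (indicator {0<..} s *\<^sub>R exp (- ((z + of_real t) * of_real s))) * complex_of_real (rho t)"
    for t s :: real
  have fs: "integrable lborel (f t) \<and> (LINT s|lborel. f t s) = of_real (rho t) / (z + of_real t)
      \<and> (LINT s|lborel. norm (f t s)) = \<bar>rho t\<bar> / (Re z + t)" for t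
  proof (cases "t \<le> 0")
    case True
    then have "f t = (\<lambda>s. 0)" "rho t = 0" by (auto simp: f_def rho_def)
    then show ?thesis by simp
  next
    case False
    then have w: "0 < Re (z + of_real t)" "0 < Re (of_real (Re z + t))" using z by auto
    have "(LINT s|lborel. norm (f t s)) = (LINT s|lborel. indicator {0<..} s *\<^sub>R exp (- ((Re z + t) * s)) * \<bar>rho t\<bar>)"
      by (intro Bochner_Integration.integral_cong) (auto simp: f_def norm_mult)
    also have "\<dots> = (LINT s|lborel. indicator {0<..} s *\<^sub>R exp (- ((Re z + t) * s))) * \<bar>rho t\<bar>"
      by simp
    also have "(LINT s|lborel. indicator {0<..} s *\<^sub>R exp (- ((Re z + t) * s))) = 1 / (Re z + t)"
    proof -
      have "complex_of_real (LINT s|lborel. indicator {0<..} s *\<^sub>R exp (- ((Re z + t) * s))) =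
        (LINT s|lborel. indicator {0<..} s *\<^sub>R exp (- (of_real (Re z + t) * of_real s)))"
        unfolding integral_complex_of_real[symmetric]
        by (intro Bochner_Integration.integral_cong) (auto simp: scaleR_conv_of_real exp_of_real[symmetric])
      also have "\<dots> = of_real (1 / (Re z + t))"
        using exp_half_line_integral(2)[OF w(2)] by simp
      finally show ?thesis by (simp only: of_real_eq_iff)
    qed
    finally have norm: "(LINT s|lborel. norm (f t s)) = \<bar>rho t\<bar> / (Re z + t)" by simp
    have "integrable lborel (f t)"
      unfolding f_def[abs_def] by (rule integrable_mult_left) (rule exp_half_line_integral(1)[OF w(1)])
    moreover have "(LINT s|lborel. f t s) = of_real (rho t) / (z + of_real t)"
      unfolding f_def integral_mult_left_zero exp_half_line_integral(2)[OF w(1)] by simp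
    ultimately show ?thesis using norm by blast
  qed
  have meas: "case_prod f \<in> borel_measurable (lborel \<Otimes>\<^sub>M lborel)"
    unfolding f_def[abs_def] by measurable
  have int: "integrable (lborel \<Otimes>\<^sub>M lborel) (case_prod f)"
  proof (rule lborel_pair.Fubini_integrable[OF meas])
    \<comment> \<open>The inner integral of the modulus is at most |rho t| / Re z, which justifies
      the exchange.\<close>
    have "integrable lborel (\<lambda>t. \<bar>rho t\<bar> / (Re z + t))"
    proof (rule Bochner_Integration.integrable_bound)
      show "integrable lborel (\<lambda>t. rho t / Re z)" using integrable_rho by simp
      show "AE t in lborel. norm (\<bar>rho t\<bar> / (Re z + t)) \<le> norm (rho t / Re z)"
      proof (intro AE_I2)
        fix t
        show "norm (\<bar>rho t\<bar> / (Re z + t)) \<le> norm (rho t / Re z)"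
        proof (cases "t \<le> 0")
          case False
          then show ?thesis using z by (auto intro!: divide_left_mono)
        qed (simp add: rho_def)
      qed
    qed measurable
    then show "integrable lborel (\<lambda>t. LINT s|lborel. norm (case_prod f (t, s)))"
      using fs by simp
    show "AE t in lborel. integrable lborel (\<lambda>s. case_prod f (t, s))"
      using fs by simp
  qed
  have ft: "(LINT t|lborel. f t s) = indicator {0<..} s *\<^sub>R (exp (- (z * of_real s)) * of_real (phi s))" for s
  proof -
    have "(LINT t|lborel. f t s) = (LINT t|lborel. (indicator {0<..} s *\<^sub>R exp (- (z * of_real s))) * of_real (exp (- (s * t)) * rho t))"
    proof (intro Bochner_Integration.integral_cong refl)
      fix t
      have "exp (- ((z + of_real t) * of_real s)) = exp (- (z * of_real s)) * of_real (exp (- (s * t)))"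
        by (simp add: exp_of_real[symmetric] exp_add[symmetric] algebra_simps)
      then show "f t s = (indicator {0<..} s *\<^sub>R exp (- (z * of_real s))) * of_real (exp (- (s * t)) * rho t)"
        by (simp add: f_def)
    qed
    also have "\<dots> = (indicator {0<..} s *\<^sub>R exp (- (z * of_real s))) * of_real (phi s)"
      unfolding phi_eq integral_complex_of_real[symmetric] by (rule integral_mult_right_zero)
    finally show ?thesis by simp
  qed
  show "integrable lborel (\<lambda>s. indicator {0<..} s *\<^sub>R (exp (- (z * of_real s)) * of_real (phi s)))"
    using lborel_pair.integrable_snd[OF int] by (simp add: ft)
  have "1 - G z = (LINT t|lborel. LINT s|lborel. f t s)"
    using Stieltjes_representation[OF z] fs by simp
  also have "\<dots> = (LINT s|lborel. LINT t|lborel. f t s)"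
    by (rule lborel_pair.Fubini_integral[OF int, symmetric])
  finally show "1 - G z = (LINT s|lborel. indicator {0<..} s *\<^sub>R (exp (- (z * of_real s)) * of_real (phi s)))"
    by (simp add: ft)
qed

section \<open>The Fourier transform on vertical lines\<close>

lemma borel_measurable_phi [measurable]: "phi \<in> borel_measurable borel"
  unfolding phi_eq[abs_def] by measurable

text \<open>Real part of the Laplace integrand at the real point \<open>a\<close>; including the
  endpoint 0 changes it on a null set only.\<close>

lemma integrable_exp_phi:
  assumes "0 < a"
  shows "integrable lborel (\<lambda>s. exp (- (a * s)) * phi s * indicator {0..} s)"
proof -
  have "integrable lborel (\<lambda>s. Re (indicator {0<..} s *\<^sub>R (exp (- (of_real a * of_real s)) * of_real (phi s))))"
    using Laplace_phi(1)[of "of_real a"] assms by (intro integrable_Re) simp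
  moreover have "Re (indicator {0<..} s *\<^sub>R (exp (- (of_real a * of_real s)) * of_real (phi s)))
      = indicator {0<..} s * exp (- (a * s)) * phi s" for s
    by (simp add: Re_exp)
  ultimately have "integrable lborel (\<lambda>s. indicator {0<..} s * exp (- (a * s)) * phi s)" by (simp only:)
  then show ?thesis
  proof (rule integrable_cong_AE_imp)
    show "AE s in lborel. indicator {0<..} s * exp (- (a * s)) * phi s = exp (- (a * s)) * phi s * indicator {0..} s"
      using AE_lborel_singleton[of 0] by eventually_elim (auto simp: indicator_def)
  qed measurable
qed

lemma exp_phi_nonneg: "0 \<le> exp (- (a * s)) * phi s * indicator {0..} s"
  using phi_nonneg[of s] integral_rho_nonneg by (simp add: indicator_def)

lemma one_minus_G_eq_fourier_transform:
  assumes "0 < a"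
  shows "1 - G (of_real a + \<i> * of_real t) =
    fourier_transform (\<lambda>s. of_real (exp (- (a * s)) * phi s * indicator {0..} s)) t"
proof -
  have "1 - G (of_real a + \<i> * of_real t) = (LINT s|lborel. indicator {0<..} s *\<^sub>R
     (exp (- ((of_real a + \<i> * of_real t) * of_real s)) * of_real (phi s)))"
    using assms by (intro Laplace_phi) simp
  also have "\<dots> = fourier_transform (\<lambda>s. of_real (exp (- (a * s)) * phi s * indicator {0..} s)) t"
    unfolding fourier_transform_def
  proof (rule integral_cong_AE)
    show "AE s in lborel. indicator {0<..} s *\<^sub>R (exp (- ((of_real a + \<i> * of_real t) * of_real s)) * of_real (phi s))
       = exp (- (\<i> * of_real t * of_real s)) * of_real (exp (- (a * s)) * phi s * indicator {0..} s)"
      using AE_lborel_singleton[of 0]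
    proof eventually_elim
      case (elim s)
      have "exp (- ((of_real a + \<i> * of_real t) * of_real s)) = exp (- (\<i> * of_real t * of_real s)) * of_real (exp (- (a * s)))"
        by (simp add: exp_of_real[symmetric] exp_add[symmetric] algebra_simps)
      then show ?case using elim by (simp add: indicator_def)
    qed
  qed measurable
  finally show ?thesis .
qed

text \<open>On each vertical line, 1 - G is the Fourier transform of a nonnegative integrable
  function, and all three parts are read off from this. Membership of G(a) in the reals makes the
  last inequality of (ii) the intended comparison with G(a) itself.\<close>

theorem corollary1p3:
  shows
    "(\<forall>a::real. a > 0 \<longrightarrow>
        (\<forall>t::real. 1 - G (complex_of_real a + \<i> * complex_of_real t) =
           (LINT s:{0..}|lborel. exp (- (\<i> * complex_of_real t * complex_of_real s))
              * complex_of_real (exp (- (a * s)) * phi s))) \<and>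
        real_analytic (\<lambda>t. 1 - G (complex_of_real a + \<i> * complex_of_real t)) \<and>
        positive_definite (\<lambda>t. 1 - G (complex_of_real a + \<i> * complex_of_real t)) \<and>
        integrable lborel
          (\<lambda>s. complex_of_real (exp (- (a * s)) * phi s * indicator {0..} s)) \<and>
        (\<lambda>t. 1 - G (complex_of_real a + \<i> * complex_of_real t)) =
          fourier_transform
            (\<lambda>s. complex_of_real (exp (- (a * s)) * phi s * indicator {0..} s)))
     \<and>
     (\<forall>a::real. a > 0 \<longrightarrow>
        continuous_on UNIV
          (\<lambda>t::real. G (complex_of_real a + \<i> * complex_of_real t) - G (complex_of_real a)) \<and>
        negative_definite
          (\<lambda>t. G (complex_of_real a + \<i> * complex_of_real t) - G (complex_of_real a)) \<and>
        G (complex_of_real a) \<in> \<real> \<and>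
        (\<forall>t::real. Re (G (complex_of_real a + \<i> * complex_of_real t))
                     \<ge> Re (G (complex_of_real a))))
     \<and>
     (\<forall>a::real. a \<ge> 1 \<longrightarrow>
        continuous_on UNIV (\<lambda>t::real. G (complex_of_real a + \<i> * complex_of_real t)) \<and>
        negative_definite (\<lambda>t. G (complex_of_real a + \<i> * complex_of_real t)))"
proof -
  let ?f = "\<lambda>a s. exp (- (a * s)) * phi s * indicator {0..} s"
  let ?F = "\<lambda>a. fourier_transform (\<lambda>s. complex_of_real (?f a s))"
  let ?l = "\<lambda>a t. complex_of_real a + \<i> * complex_of_real t"
  have F: "1 - G (?l a t) = ?F a t" if "0 < a" for a t
    using that by (rule one_minus_G_eq_fourier_transform)
  \<comment> \<open>At t = 0 the transform equals 1 - G(a), so the constant 1 drops out of the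
    difference.\<close>
  have F_diff: "G (?l a t) - G (of_real a) = ?F a 0 - ?F a t" if "0 < a" for a t
    using F[OF that, of t] F[OF that, of 0] by (simp add: algebra_simps)
  have cont: "continuous_on UNIV (\<lambda>t. G (?l a t))" if "0 < a" for a
    by (intro continuous_on_compose2[OF holomorphic_on_imp_continuous_on[OF holomorphic_on_G]] continuous_intros)
      (use that in auto)
  have neg: "negative_definite (\<lambda>t. of_real b + (?F a 0 - ?F a t))" if "0 < a" "0 \<le> b" for a b
    using integrable_exp_phi[OF that(1)] exp_phi_nonneg that(2) by (rule negative_definite_fourier)
  show ?thesis
  proof (intro conjI allI impI)
    fix a t :: real assume a: "0 < a"
    show "1 - G (?l a t) = (LINT s:{0..}|lborel. exp (- (\<i> * complex_of_real t * complex_of_real s))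
              * complex_of_real (exp (- (a * s)) * phi s))"
      unfolding F[OF a] fourier_transform_def set_lebesgue_integral_def
      by (intro Bochner_Integration.integral_cong) (auto simp: indicator_def)
  next
    fix a :: real assume a: "0 < a"
    show "real_analytic (\<lambda>t. 1 - G (?l a t))"
      using a by (intro real_analytic_vertical_line[where f = "\<lambda>z. 1 - G z"] holomorphic_intros holomorphic_on_G)
    show "positive_definite (\<lambda>t. 1 - G (?l a t))"
      unfolding F[OF a] by (intro positive_definite_fourier integrable_exp_phi exp_phi_nonneg a)
    show "integrable lborel (\<lambda>s. complex_of_real (?f a s))"
      using integrable_exp_phi[OF a] by (rule integrable_of_real)
    show "(\<lambda>t. 1 - G (?l a t)) = ?F a"
      using F[OF a] by blast
  next
    fix a :: real assume a: "0 < a"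
    show "continuous_on UNIV (\<lambda>t. G (?l a t) - G (of_real a))"
      by (intro continuous_intros cont a)
    show nd: "negative_definite (\<lambda>t. G (?l a t) - G (of_real a))"
      using neg[OF a, of 0] by (simp add: F_diff[OF a])
    show "G (of_real a) \<in> \<real>" using a by (simp add: G_of_real)
    show "Re (G (?l a t)) \<ge> Re (G (of_real a))" for t
      using Re_negative_definite_nonneg[OF nd, of t] by simp
  next
    fix a :: real assume a: "1 \<le> a"
    then have a0: "0 < a" by simp
    show "continuous_on UNIV (\<lambda>t. G (?l a t))" by (intro cont a0)
    \<comment> \<open>This is G(a). Its sign is where \<open>1 \<le> a\<close> enters, through ln a
      \<ge> 0; for smaller positive a it would be negative.\<close>
    define b where "b = (1 - ln a / ln (1 + a)) * a * ln a"
    have "ln a / ln (1 + a) \<le> 1" using a by simp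
    then have "0 \<le> b" using a by (simp add: b_def)
    moreover have "G (?l a t) = of_real b + (?F a 0 - ?F a t)" for t
      using F_diff[OF a0, of t] G_of_real[OF a0] by (simp add: b_def algebra_simps)
    ultimately show "negative_definite (\<lambda>t. G (?l a t))"
      using neg[OF a0] by simp
  qed
qed

end
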